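(* Let $k,l,n\in\mathbb N^\star$, $r>0$ and $0<\underline\rho<\overline\rho$. Let $E=\mathbb R^k$ and $\mu=\mathcal N(0,2\overline\rho^2I_k)$, and put $M=\sqrt k\,\overline\rho+r$, $b=r^2/(2\overline\rho^2)+k\log(\sqrt2\,\overline\rho/\underline\rho)$, $R=\sqrt{k/2}\,e^{-b/2}\underline\rho^{-1}$ and, for $\tau>0$, $$\mathcal L(\tau)=\frac12\log\left(\frac{4le^{2b}\tau^{-1}}{1+k(k+1)}\right).$$ There exists an estimator $\widehat s=\widehat s(X_1,\dots,X_n)$ such that, for some universal constant $C>0$ and every bounded density $s\in L_2(E,\mu)$ (with respect to $\mu$), with $\tau=n^{-1}\|s\|_\infty(1\vee\log\|s\|_\infty)$, $$C\,\mathbb E_s\left[d^2(s,\widehat s)\right]\le\inf\left[d^2(s,g\circ u)\right]+lk(k+1)\tau\left[\log(1+2MR)+(\mathcal L(\tau)\vee1)\right],$$ where the infimum runs among all functions $u=(u_1,\dots,u_l)\in\boldsymbol T^l$ and all $g$ of the form $g(y_1,\dots,y_l)=e^bq_1y_1^2+\dots+e^bq_ly_l^2$ with $(q_1,\dots,q_l)\in[0,1]^l$, $\sum_{j=1}^lq_j=1$.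
   Context: Framework: density estimation. $X_1,\dots,X_n$ are i.i.d. with unknown density $s$ with respect to $\mu$ on $E=\mathbb R^k$; $\mathbb E_s$ is the corresponding expectation; $d$ is the $L_2(E,\mu)$-distance. An estimator is a measurable function of the observations with values in $L_2(E,\mu)$ (it does not depend on $s$). A subprobability on a countable set $A$ is a positive measure $\pi$ on $A$ with $\pi(A)\le1$; $\Delta_\pi(a)=-\log\pi(\{a\})$ ($=+\infty$ if $\pi(\{a\})=0$). Standing assumption (known model selection theorem, may be used): there is a universal constant $C_0>0$ such that for every countable family $\mathbb S$ of finite-dimensional linear subspaces of $L_2(E,\mu)$ and every subprobability $\pi$ on $\mathbb S$ there is an estimator $\widetilde s$ with values in $\bigcup_{S\in\mathbb S}S$ satisfying, for every bounded density $s$, with $\tau=n^{-1}\|s\|_\infty(1\vee\log\|s\|_\infty)$, $\mathbb E_s[d^2(s,\widetilde s)]\le C_0\inf_{S\in\mathbb S}\{d^2(s,S)+\tau[(\dim S\vee1)+\Delta_\pi(S)]\}$. Gaussian densities. $\Theta$ is the set of pairs $\theta=(m,\Sigma)$ where $m\in\mathbb R^k$ has Euclidean norm at most $r$ and $\Sigma$ is a symmetric positive definite $k\times k$ matrix with all eigenvalues in $[\underline\rho,\overline\rho]$. For $\theta=(m,\Sigma)$, $p(\theta,\cdot)=p(m,\Sigma,\cdot)=d\mathcal N(m,\Sigma^2)/d\mu$ is the density with respect to $\mu$ of the Gaussian distribution with mean $m$ and covariance matrix $\Sigma^2$. The parametric set $\boldsymbol T$ is $$\boldsymbol T=\left\{u(\theta,\cdot)=e^{-b/2}\sqrt{p(\theta,\cdot)},\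 \theta\in\Theta\right\}$$ (its elements take values in $[-1,1]$), so that $g\circ u$ in the claim runs over the Gaussian mixtures $\sum_{j=1}^lq_jp(\theta_j,\cdot)$ with $\theta_j\in\Theta$. *)

theory Defs
  imports
    "HOL-Probability.Probability"
    "Jordan_Normal_Form.Determinant"
    "Jordan_Normal_Form.Char_Poly"
    "Jordan_Normal_Form.Gauss_Jordan_Elimination"
begin

text \<open>
  Elements of $L_2(\mu)$ are represented by square integrable functions; only notions that are
  invariant under almost everywhere equality are used, so \<open>L2_dist\<close> is a pseudometric on
  representatives that induces the usual distance on classes.
\<close>

definition L2_fun :: "'a measure \<Rightarrow> ('a \<Rightarrow> real) set" where
  "L2_fun M = {f \<in> borel_measurable M. integrable M (\<lambda>x. (f x)\<^sup>2)}"

definition L2_dist :: "'a measure \<Rightarrow> ('a \<Rightarrow> real) \<Rightarrow> ('a \<Rightarrow> real) \<Rightarrow> real" where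
  "L2_dist M f g = sqrt (LINT x|M. (f x - g x)\<^sup>2)"

definition L2_setdist :: "'a measure \<Rightarrow> ('a \<Rightarrow> real) \<Rightarrow> ('a \<Rightarrow> real) set \<Rightarrow> real" where
  "L2_setdist M f S = (INF t\<in>S. L2_dist M f t)"

text \<open>The Borel sigma-algebra of the (pseudo)metric space $L_2(\mu)$.\<close>

definition L2_borel :: "'a measure \<Rightarrow> ('a \<Rightarrow> real) measure" where
  "L2_borel M = sigma (L2_fun M)
     {U. U \<subseteq> L2_fun M \<and> (\<forall>f\<in>U. \<exists>e>0. \<forall>g\<in>L2_fun M. L2_dist M f g < e \<longrightarrow> g \<in> U)}"

text \<open>
  Linear subspaces of $L_2(\mu)$ correspond to linear sets of representatives that are closed
  under almost everywhere equality; hence spans and dimensions are taken modulo null sets.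
\<close>

definition L2_span :: "'a measure \<Rightarrow> ('a \<Rightarrow> real) set \<Rightarrow> ('a \<Rightarrow> real) set" where
  "L2_span M B = {f \<in> L2_fun M. \<exists>c. AE x in M. f x = (\<Sum>h\<in>B. c h * h x)}"

definition fin_dim_subspace :: "'a measure \<Rightarrow> ('a \<Rightarrow> real) set \<Rightarrow> bool" where
  "fin_dim_subspace M S \<longleftrightarrow> (\<exists>B. finite B \<and> B \<subseteq> L2_fun M \<and> S = L2_span M B)"

definition L2_dim :: "'a measure \<Rightarrow> ('a \<Rightarrow> real) set \<Rightarrow> nat" where
  "L2_dim M S = (LEAST d. \<exists>B. finite B \<and> card B = d \<and> B \<subseteq> L2_fun M \<and> S = L2_span M B)"

definition Linf_norm :: "'a measure \<Rightarrow> ('a \<Rightarrow> real) \<Rightarrow> ereal" where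
  "Linf_norm M s = esssup M (\<lambda>x. ereal \<bar>s x\<bar>)"

definition bounded_density :: "'a measure \<Rightarrow> ('a \<Rightarrow> real) \<Rightarrow> bool" where
  "bounded_density M s \<longleftrightarrow>
     s \<in> borel_measurable M \<and> (AE x in M. 0 \<le> s x) \<and>
     (\<integral>\<^sup>+x. ennreal (s x) \<partial>M) = 1 \<and> Linf_norm M s < \<infinity>"

definition tau :: "nat \<Rightarrow> 'a measure \<Rightarrow> ('a \<Rightarrow> real) \<Rightarrow> real" where
  "tau n M s = (let N = real_of_ereal (Linf_norm M s) in N * max 1 (ln N) / real n)"

text \<open>A sample $(X_1,\dots,X_n)$ is a point of the product space indexed by \<open>{..<n}\<close>.\<close>

definition estimator :: "nat \<Rightarrow> 'a measure \<Rightarrow> ((nat \<Rightarrow> 'a) \<Rightarrow> 'a \<Rightarrow> real) \<Rightarrow> bool" where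
  "estimator n M shat \<longleftrightarrow> shat \<in> measurable (PiM {..<n} (\<lambda>_. M)) (L2_borel M)"

definition L2_risk ::
  "nat \<Rightarrow> 'a measure \<Rightarrow> ('a \<Rightarrow> real) \<Rightarrow> ((nat \<Rightarrow> 'a) \<Rightarrow> 'a \<Rightarrow> real) \<Rightarrow> ennreal" where
  "L2_risk n M s shat =
     (\<integral>\<^sup>+X. ennreal ((L2_dist M s (shat X))\<^sup>2) \<partial>(PiM {..<n} (\<lambda>_. density M (\<lambda>x. ennreal (s x)))))"

definition Delta :: "'b measure \<Rightarrow> 'b \<Rightarrow> ennreal" where
  "Delta \<pi> a = (if measure \<pi> {a} = 0 then \<infinity> else ennreal (- ln (measure \<pi> {a})))"

text \<open>
  The conclusion of the model selection theorem with constant \<open>C0\<close>, for \<open>n\<close> observations and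
  dominating measure \<open>M\<close>. The predicate \<open>subprob_space\<close> forces the family to be nonempty,
  without which no estimator could take its values in the union.
\<close>

definition model_selection :: "real \<Rightarrow> nat \<Rightarrow> 'a measure \<Rightarrow> bool" where
  "model_selection C0 n M \<longleftrightarrow>
     (\<forall>SS \<pi>. countable SS \<and> (\<forall>S\<in>SS. fin_dim_subspace M S) \<and>
        subprob_space \<pi> \<and> sets \<pi> = Pow SS \<longrightarrow>
        (\<exists>shat. estimator n M shat \<and>
           (\<forall>X\<in>space (PiM {..<n} (\<lambda>_. M)). shat X \<in> \<Union>SS) \<and>
           (\<forall>s. bounded_density M s \<longrightarrow>
              L2_risk n M s shat \<le> ennreal C0 *
                (INF S\<in>SS. ennreal ((L2_setdist M s S)\<^sup>2) +
                   ennreal (tau n M s) * (ennreal (real (max (L2_dim M S) 1)) + Delta \<pi> S)))))"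

text \<open>
  Since the dimension \<open>k\<close> has to be quantified inside the statement, $R^k$ is the product space
  \<open>PiM {..<k} (\<lambda>_. lborel)\<close>; \<open>vec k x\<close> turns one of its points into a vector.
\<close>

definition gaussian_lebesgue_density :: "nat \<Rightarrow> real vec \<Rightarrow> real mat \<Rightarrow> (nat \<Rightarrow> real) \<Rightarrow> real" where
  "gaussian_lebesgue_density k m V x =
     (let z = Matrix.vec k x - m in
      exp (- scalar_prod z (the (mat_inverse V) *\<^sub>v z) / 2) / sqrt ((2 * pi) ^ k * Determinant.det V))"

definition gaussian :: "nat \<Rightarrow> real vec \<Rightarrow> real mat \<Rightarrow> (nat \<Rightarrow> real) measure" where
  "gaussian k m V =
     density (PiM {..<k} (\<lambda>_. lborel)) (\<lambda>x. ennreal (gaussian_lebesgue_density k m V x))"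

definition base_measure :: "nat \<Rightarrow> real \<Rightarrow> (nat \<Rightarrow> real) measure" where
  "base_measure k \<rho> = gaussian k (0\<^sub>v k) ((2 * \<rho>\<^sup>2) \<cdot>\<^sub>m 1\<^sub>m k)"

definition sym_pos_def :: "nat \<Rightarrow> real mat \<Rightarrow> bool" where
  "sym_pos_def k A \<longleftrightarrow> A \<in> carrier_mat k k \<and> transpose_mat A = A \<and>
     (\<forall>v\<in>carrier_vec k. v \<noteq> 0\<^sub>v k \<longrightarrow> 0 < scalar_prod v (A *\<^sub>v v))"

definition Theta :: "nat \<Rightarrow> real \<Rightarrow> real \<Rightarrow> real \<Rightarrow> (real vec \<times> real mat) set" where
  "Theta k r \<rho>l \<rho>u =
     {(m, \<Sigma>). m \<in> carrier_vec k \<and> sqrt (scalar_prod m m) \<le> r \<and>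
        sym_pos_def k \<Sigma> \<and> (\<forall>a. eigenvalue \<Sigma> a \<longrightarrow> a \<in> {\<rho>l..\<rho>u})}"

definition gauss_p :: "nat \<Rightarrow> real \<Rightarrow> real vec \<times> real mat \<Rightarrow> (nat \<Rightarrow> real) \<Rightarrow> real" where
  "gauss_p k \<rho>u = (\<lambda>(m, \<Sigma>) x. enn2real (RN_deriv (base_measure k \<rho>u) (gaussian k m (\<Sigma> * \<Sigma>)) x))"

definition T_set :: "nat \<Rightarrow> real \<Rightarrow> real \<Rightarrow> real \<Rightarrow> real \<Rightarrow> ((nat \<Rightarrow> real) \<Rightarrow> real) set" where
  "T_set k r \<rho>l \<rho>u b = (\<lambda>\<theta> x. exp (- b / 2) * sqrt (gauss_p k \<rho>u \<theta> x)) ` Theta k r \<rho>l \<rho>u"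

definition mixing_forms :: "nat \<Rightarrow> real \<Rightarrow> ((nat \<Rightarrow> real) \<Rightarrow> real) set" where
  "mixing_forms l b =
     {(\<lambda>y. \<Sum>j<l. exp b * q j * (y j)\<^sup>2) | q. (\<forall>j<l. q j \<in> {0..1}) \<and> (\<Sum>j<l. q j) = 1}"

end

theory Submission
  imports Defs
begin

text \<open>
  The estimator comes from the model selection theorem, applied to spaces spanned by \<open>l\<close> functions
  that are taken from finite nets of the set of densities $p(\theta,\cdot)$. The point is that $b$ is
  large: $k$, $\log(\overline\rho/\underline\rho)$ and $(r/\overline\rho)^2$ are at most
  a constant times $b$, so that all quantities attached to $\Theta$ are bounded by a power of $e^b$,
  and logarithms of such quantities cost only $O(b)$.

  A density $p(\theta,\cdot)$ is the exponential of a quadratic polynomial in $x/\overline\rho$. Its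
  $(k+1)^2$ coefficients are at most $e^{8b}$ and the polynomial is at most $b$ everywhere
  (\<open>log_quadratic\<close>, \<open>gauss_p_exp_quad\<close>). When the coefficients are rounded to multiples of $2^{-i}$
  and the exponent is cut off at $b$, the density moves by at most $2^{-i}$ times a power of $e^b$ in
  $L_2(\mu)$, because the exponential is $e^b$-Lipschitz below $b$ and polynomials have Gaussian
  moments (\<open>mixture_near_net\<close>). The spaces of level $i$ number at most
  $\exp(2(i+1)(k+1)^2l)$. The weights $2^{-i-1}$ on levels, shared equally within a level, make the
  penalty of level $i$ of order $lk(k+1)\tau(i+1)$ (\<open>model_selection_over_finite_families\<close>).

  There are two regimes (\<open>risk_bound\<close>). If $lk(k+1)\tau\ge e^b$, the zero function approximates
  well enough: a mixture $f$ has $\|f\|^2\le\sup f\int f\,d\mu\le e^b$. If $lk(k+1)\tau<e^b$,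
  the definition of $\mathcal L$ gives $b\le2\mathcal L(\tau)$, so that a power of $e^b$ is
  compensated by a level $i$ proportional to $\mathcal L(\tau)\vee1$ (\<open>level_choice\<close>); then the
  squared approximation error is at most $2lk(k+1)\tau$.

  The first regime needs $\int p(\theta,\cdot)\,d\mu=1$ for every covariance matrix, that is the
  Gaussian integral of a general positive definite form. It is computed by induction on the dimension,
  integrating out one coordinate and passing to the Schur complement
  (\<open>det_pos_and_nn_integral_gaussian\<close>). The eigenvalue condition in $\Theta$ is translated into
  bounds on the quadratic form of the inverse covariance matrix
  (\<open>mat_inverse_square_symmetric\<close>); bounds on its determinant then follow by comparing Gaussian
  integrals (\<open>det_bounds_of_form_bounds\<close>).
\<close>

section \<open>Gaussian integrals of positive definite quadratic forms\<close>

definition quad :: "nat \<Rightarrow> (nat \<Rightarrow> nat \<Rightarrow> real) \<Rightarrow> (nat \<Rightarrow> real) \<Rightarrow> real" where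
  "quad n w x = (\<Sum>i<n. \<Sum>j<n. w i j * x i * x j)"

text \<open>
  The coordinate eliminated is the last one, with index \<open>n\<close>.
\<close>

definition schur_complement :: "nat \<Rightarrow> (nat \<Rightarrow> nat \<Rightarrow> real) \<Rightarrow> nat \<Rightarrow> nat \<Rightarrow> real" where
  "schur_complement n w i j = w i j - w i n * w n j / w n n"

lemma quad_cong:
  assumes "\<And>i. i < n \<Longrightarrow> x i = y i"
  shows "quad n w x = quad n w y"
  unfolding quad_def using assms by (intro sum.cong) auto

text \<open>
  Completing the square in the last coordinate; what remains is a form in the other coordinates.
\<close>

lemma quad_Suc_schur_complement:
  assumes sym: "\<And>i j. i < Suc n \<Longrightarrow> j < Suc n \<Longrightarrow> w i j = w j i" and a: "w n n \<noteq> 0"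
  shows "quad (Suc n) w x = quad n (schur_complement n w) x +
    w n n * (x n + (\<Sum>i<n. w i n * x i) / w n n)\<^sup>2"
proof -
  define c where "c = (\<Sum>i<n. w i n * x i)"
  have "quad (Suc n) w x = quad n w x + (\<Sum>i<n. w i n * x i * x n) + (\<Sum>j<n. w n j * x n * x j)
      + w n n * x n * x n"
    unfolding quad_def by (simp add: sum.distrib)
  also have "(\<Sum>i<n. w i n * x i * x n) = c * x n"
    unfolding c_def by (simp add: sum_distrib_right)
  also have "(\<Sum>j<n. w n j * x n * x j) = c * x n"
    unfolding c_def sum_distrib_right by (intro sum.cong) (auto simp: sym mult_ac)
  finally have 1: "quad (Suc n) w x = quad n w x + 2 * c * x n + w n n * x n * x n" by simp
  have "(\<Sum>i<n. \<Sum>j<n. w i n * w n j / w n n * x i * x j) = (\<Sum>i<n. \<Sum>j<n. (w i n * x i) * (w j n * x j)) / w n n"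
    unfolding sum_divide_distrib by (intro sum.cong refl) (auto simp: sym)
  also have "\<dots> = c * c / w n n"
    unfolding c_def by (simp add: sum_product)
  finally have 2: "quad n (schur_complement n w) x = quad n w x - c * c / w n n"
    unfolding quad_def schur_complement_def by (simp add: sum_subtractf left_diff_distrib)
  show ?thesis
    unfolding 1 2 c_def[symmetric] using a by (simp add: field_simps power2_eq_square)
qed

text \<open>
  A column operation, multiplication by a unipotent matrix, clears the last row except for its corner.
\<close>

lemma det_Suc_schur_complement:
  assumes a: "w n n \<noteq> 0"
  shows "Determinant.det (Matrix.mat (Suc n) (Suc n) (\<lambda>(i,j). w i j)) =
    Determinant.det (Matrix.mat n n (\<lambda>(i,j). schur_complement n w i j)) * w n n"
proof -
  let ?A1 = "Matrix.mat n n (\<lambda>(i,j). w i j)" and ?A2 = "Matrix.mat n 1 (\<lambda>(i,j). w i n)"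
  let ?A3 = "Matrix.mat 1 n (\<lambda>(i,j). w n j)" and ?A4 = "Matrix.mat 1 1 (\<lambda>(i,j). w n n)"
  let ?E3 = "Matrix.mat 1 n (\<lambda>(i,j). - w n j / w n n)"
  let ?A = "Matrix.mat (Suc n) (Suc n) (\<lambda>(i,j). w i j)"
  let ?E = "four_block_mat (1\<^sub>m n) (0\<^sub>m n 1) ?E3 (1\<^sub>m 1)"
  let ?S = "Matrix.mat n n (\<lambda>(i,j). schur_complement n w i j)"
  have A: "?A = four_block_mat ?A1 ?A2 ?A3 ?A4"
    by (rule eq_matI) (auto simp: less_Suc_eq)
  have "?A * ?E = four_block_mat (?A1 * 1\<^sub>m n + ?A2 * ?E3) (?A1 * 0\<^sub>m n 1 + ?A2 * 1\<^sub>m 1)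
      (?A3 * 1\<^sub>m n + ?A4 * ?E3) (?A3 * 0\<^sub>m n 1 + ?A4 * 1\<^sub>m 1)"
    unfolding A by (rule mult_four_block_mat) auto
  also have "?A1 * 1\<^sub>m n + ?A2 * ?E3 = ?S"
    by (rule eq_matI) (auto simp: schur_complement_def scalar_prod_def)
  also have "?A1 * 0\<^sub>m n 1 + ?A2 * 1\<^sub>m 1 = ?A2"
    by (rule eq_matI) (auto simp: scalar_prod_def)
  also have "?A3 * 1\<^sub>m n + ?A4 * ?E3 = 0\<^sub>m 1 n"
    using a by (intro eq_matI) (auto simp: scalar_prod_def)
  also have "?A3 * 0\<^sub>m n 1 + ?A4 * 1\<^sub>m 1 = ?A4"
    by (rule eq_matI) (auto simp: scalar_prod_def)
  finally have AE: "?A * ?E = four_block_mat ?S ?A2 (0\<^sub>m 1 n) ?A4" .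
  have "Determinant.det (?A * ?E) = Determinant.det ?A * Determinant.det ?E"
    by (rule det_mult[where n="Suc n"]) (auto intro!: carrier_matI)
  also have "Determinant.det ?E = 1"
    by (subst det_four_block_mat_upper_right_zero_col[where n=n]) auto
  finally have "Determinant.det ?A = Determinant.det (four_block_mat ?S ?A2 (0\<^sub>m 1 n) ?A4)"
    unfolding AE by simp
  also have "\<dots> = Determinant.det ?S * Determinant.det ?A4"
    by (rule det_four_block_mat_lower_left_zero) auto
  also have "Determinant.det ?A4 = w n n" by (subst det_single) auto
  finally show ?thesis .
qed

lemma nn_integral_gaussian_shift:
  assumes "0 < (a::real)"
  shows "(\<integral>\<^sup>+y. ennreal (exp (- (a * (y + t)\<^sup>2) / 2)) \<partial>lborel) = ennreal (sqrt (2 * pi / a))"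
proof -
  interpret prob_space "density lborel (normal_density (- t) (1 / sqrt a))"
    using assms by (intro prob_space_normal_density) auto
  have "exp (- (a * (y + t)\<^sup>2) / 2) = sqrt (2 * pi / a) * normal_density (- t) (1 / sqrt a) y" for y
    using assms by (simp add: normal_density_def field_simps real_sqrt_divide power_divide real_sqrt_mult)
  then have "(\<integral>\<^sup>+y. ennreal (exp (- (a * (y + t)\<^sup>2) / 2)) \<partial>lborel) =
      (\<integral>\<^sup>+y. ennreal (sqrt (2 * pi / a)) * ennreal (normal_density (- t) (1 / sqrt a) y) \<partial>lborel)"
    using assms by (intro nn_integral_cong) (simp add: ennreal_mult)
  also have "\<dots> = ennreal (sqrt (2 * pi / a)) * (\<integral>\<^sup>+y. ennreal (normal_density (- t) (1 / sqrt a) y) \<partial>lborel)"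
    by (rule nn_integral_cmult) auto
  also have "(\<integral>\<^sup>+y. ennreal (normal_density (- t) (1 / sqrt a) y) \<partial>lborel) = 1"
    using emeasure_space_1 by (simp add: emeasure_density)
  finally show ?thesis by simp
qed

text \<open>
  Induction on the dimension: for fixed values of the other coordinates the integral in the last
  one is a shifted one-dimensional Gaussian integral whose value does not depend on the shift, and the
  Schur complement inherits positive definiteness. Positivity of the determinant
  belongs to the same induction, since the determinant is the product of the pivots.
\<close>

lemma det_pos_and_nn_integral_gaussian:
  assumes "\<And>i j. i < n \<Longrightarrow> j < n \<Longrightarrow> w i j = w j i"
    and "\<And>x. \<exists>i<n. x i \<noteq> 0 \<Longrightarrow> 0 < quad n w x"
  shows "0 < Determinant.det (Matrix.mat n n (\<lambda>(i,j). w i j)) \<and>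
    (\<integral>\<^sup>+x. ennreal (exp (- quad n w (\<lambda>i. x i - m i) / 2)) \<partial>PiM {..<n} (\<lambda>_. lborel)) =
      ennreal (sqrt ((2 * pi) ^ n / Determinant.det (Matrix.mat n n (\<lambda>(i,j). w i j))))"
  using assms
proof (induction n arbitrary: w)
  case 0
  then show ?case by (simp add: quad_def nn_integral_empty PiM_empty nn_integral_count_space_finite)
next
  case (Suc n)
  interpret product_sigma_finite "\<lambda>_::nat. lborel :: real measure"
    by standard
  define S where "S = schur_complement n w"
  define a where "a = w n n"
  define D where "D = Determinant.det (Matrix.mat n n (\<lambda>(i,j). S i j))"
  \<comment> \<open>the form at the last unit vector is the pivot\<close>
  have "0 < quad (Suc n) w (\<lambda>i. if i = n then 1 else 0)"
    by (rule Suc.prems(2)) auto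
  then have a: "0 < a" by (simp add: quad_def a_def)
  have sym: "\<And>i j. i < Suc n \<Longrightarrow> j < Suc n \<Longrightarrow> w i j = w j i" by (rule Suc.prems(1))
  note decomp = quad_Suc_schur_complement[of n w, OF sym, folded S_def a_def]
  have S_pd: "0 < quad n S x" if "\<exists>i<n. x i \<noteq> 0" for x
  proof -
    \<comment> \<open>the last coordinate that minimizes the form, where the completed square vanishes\<close>
    let ?y = "x(n := - (\<Sum>i<n. w i n * x i) / a)"
    have "0 < quad (Suc n) w ?y" using that by (intro Suc.prems(2)) auto
    also have "\<dots> = quad n S ?y" using a by (subst decomp) auto
    also have "\<dots> = quad n S x" by (rule quad_cong) auto
    finally show ?thesis .
  qed
  have S_sym: "S i j = S j i" if "i < n" "j < n" for i j
    using that by (simp add: S_def schur_complement_def sym)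
  note IH = Suc.IH[of S, OF S_sym S_pd, folded D_def]
  have D: "0 < D" using IH by blast
  have det: "Determinant.det (Matrix.mat (Suc n) (Suc n) (\<lambda>(i,j). w i j)) = D * a"
    unfolding D_def S_def a_def using a a_def by (intro det_Suc_schur_complement) auto
  have "(\<integral>\<^sup>+x. ennreal (exp (- quad (Suc n) w (\<lambda>i. x i - m i) / 2)) \<partial>PiM {..<Suc n} (\<lambda>_. lborel)) =
     (\<integral>\<^sup>+x. (\<integral>\<^sup>+y. ennreal (exp (- quad (Suc n) w (\<lambda>i. (x(n := y)) i - m i) / 2)) \<partial>lborel)
        \<partial>PiM {..<n} (\<lambda>_. lborel))"
    unfolding lessThan_Suc
    by (intro product_nn_integral_insert) (auto simp: quad_def)
  also have "\<dots> = (\<integral>\<^sup>+x. ennreal (sqrt (2 * pi / a)) * ennreal (exp (- quad n S (\<lambda>i. x i - m i) / 2))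
        \<partial>PiM {..<n} (\<lambda>_. lborel))"
  proof (intro nn_integral_cong)
    fix x :: "nat \<Rightarrow> real"
    define t where "t = (\<Sum>i<n. w i n * (x i - m i)) / a - m n"
    define q where "q = quad n S (\<lambda>i. x i - m i)"
    have "quad (Suc n) w (\<lambda>i. (x(n := y)) i - m i) = q + a * (y + t)\<^sup>2" for y
    proof -
      have "quad n S (\<lambda>i. (x(n := y)) i - m i) = q"
        unfolding q_def by (rule quad_cong) auto
      moreover have "(\<Sum>i<n. w i n * ((x(n := y)) i - m i)) = (\<Sum>i<n. w i n * (x i - m i))"
        by (rule sum.cong) auto
      ultimately show ?thesis using a by (subst decomp) (auto simp: t_def algebra_simps)
    qed
    then have "ennreal (exp (- quad (Suc n) w (\<lambda>i. (x(n := y)) i - m i) / 2)) =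
        ennreal (exp (- q / 2)) * ennreal (exp (- (a * (y + t)\<^sup>2) / 2))" for y
      by (simp add: ennreal_mult[symmetric] exp_add[symmetric] add_divide_distrib diff_divide_distrib)
    then show "(\<integral>\<^sup>+y. ennreal (exp (- quad (Suc n) w (\<lambda>i. (x(n := y)) i - m i) / 2)) \<partial>lborel) =
        ennreal (sqrt (2 * pi / a)) * ennreal (exp (- q / 2))"
      using nn_integral_gaussian_shift[OF a, of t] by (simp add: nn_integral_cmult mult.commute)
  qed
  also have "\<dots> = ennreal (sqrt (2 * pi / a)) *
      (\<integral>\<^sup>+x. ennreal (exp (- quad n S (\<lambda>i. x i - m i) / 2)) \<partial>PiM {..<n} (\<lambda>_. lborel))"
    by (rule nn_integral_cmult) (auto simp: quad_def)
  also have "\<dots> = ennreal (sqrt (2 * pi / a) * sqrt ((2 * pi) ^ n / D))"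
    using IH a D by (simp add: ennreal_mult)
  also have "sqrt (2 * pi / a) * sqrt ((2 * pi) ^ n / D) = sqrt ((2 * pi) ^ Suc n / (D * a))"
    by (simp add: real_sqrt_mult[symmetric] field_simps)
  finally show ?case unfolding det using a D by simp
qed

section \<open>Quadratic forms and eigenvalues of symmetric matrices\<close>

lemma scalar_prod_self_eq_0:
  fixes v :: "real vec"
  assumes "v \<in> carrier_vec n"
  shows "scalar_prod v v = 0 \<longleftrightarrow> v = 0\<^sub>v n"
  using conjugate_square_eq_0_vec[OF assms] by (simp add: conjugate_real_def)

lemma scalar_prod_self_nonneg: "0 \<le> scalar_prod v v" for v :: "real vec"
  unfolding scalar_prod_def by (intro sum_nonneg) simp

lemma quadratic_form_eq_sum:
  fixes v :: "real vec"
  assumes "A \<in> carrier_mat n n" "v \<in> carrier_vec n"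
  shows "scalar_prod v (A *\<^sub>v v) =
    (\<Sum>i<n. \<Sum>j<n. A $$ (i,j) * vec_index v i * vec_index v j)"
proof -
  have "scalar_prod v (A *\<^sub>v v) = (\<Sum>i<n. vec_index v i * (\<Sum>j<n. A $$ (i,j) * vec_index v j))"
    using assms by (simp add: scalar_prod_def lessThan_atLeast0)
  then show ?thesis by (simp add: sum_distrib_left mult_ac)
qed

text \<open>
  A crude bound by the entries; only its finiteness matters below.
\<close>

lemma quadratic_form_le_sum_abs:
  fixes v :: "real vec"
  assumes A: "A \<in> carrier_mat n n" and v: "v \<in> carrier_vec n"
  shows "\<bar>scalar_prod v (A *\<^sub>v v)\<bar> \<le> (\<Sum>i<n. \<Sum>j<n. \<bar>A $$ (i,j)\<bar>) * scalar_prod v v"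
proof -
  have le: "\<bar>vec_index v i * vec_index v j\<bar> \<le> scalar_prod v v" if "i < n" "j < n" for i j
  proof -
    have sq: "vec_index v i * vec_index v i \<le> scalar_prod v v" if "i < n" for i
      unfolding scalar_prod_def using v that
      by (intro member_le_sum[where f="\<lambda>i. vec_index v i * vec_index v i"]) auto
    have "2 * \<bar>vec_index v i * vec_index v j\<bar> \<le> vec_index v i * vec_index v i + vec_index v j * vec_index v j"
      using sum_squares_bound[of "\<bar>vec_index v i\<bar>" "\<bar>vec_index v j\<bar>"]
      by (simp add: abs_mult power2_eq_square)
    with sq[OF that(1)] sq[OF that(2)] show ?thesis by linarith
  qed
  have "\<bar>scalar_prod v (A *\<^sub>v v)\<bar> \<le> (\<Sum>i<n. \<Sum>j<n. \<bar>A $$ (i,j) * vec_index v i * vec_index v j\<bar>)"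
    unfolding quadratic_form_eq_sum[OF A v]
    by (intro order_trans[OF sum_abs] sum_mono) auto
  also have "\<dots> \<le> (\<Sum>i<n. \<Sum>j<n. \<bar>A $$ (i,j)\<bar> * scalar_prod v v)"
    using le by (intro sum_mono) (simp add: abs_mult mult.assoc mult_left_mono)
  finally show ?thesis by (simp add: sum_distrib_right)
qed

lemma symmetric_bilinear:
  fixes x :: "real vec"
  assumes A: "A \<in> carrier_mat n n" and sym: "transpose_mat A = A"
    and x: "x \<in> carrier_vec n" and y: "y \<in> carrier_vec n"
  shows "scalar_prod (A *\<^sub>v x) y = scalar_prod x (A *\<^sub>v y)"
  using transpose_vec_mult_scalar[OF A y x] sym assms comm_scalar_prod[of "A *\<^sub>v x" n y]
  by (metis comm_scalar_prod mult_mat_vec_carrier)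

lemma inverse_mat_exists:
  fixes A :: "real mat"
  assumes A: "A \<in> carrier_mat n n" and d: "Determinant.det A \<noteq> 0"
  obtains B where "B \<in> carrier_mat n n" "A * B = 1\<^sub>m n" "B * A = 1\<^sub>m n"
  using det_non_zero_imp_unit[OF A d, of n] mat_inverse(1)[OF A, of n] mat_inverse(2)[OF A]
  by (metis not_None_eq)

text \<open>
  With $y=B^{-1}x$ one has $x^TBy=|x|^2$, and nonnegativity of the form at $x-ty$ gives
  $x^TBx\ge2t|x|^2-t^2\,y^Tx$, where $y^Tx\le K|x|^2$. The choice $t=1/K$ yields the bound, without any
  compactness argument.
\<close>

lemma psd_regular_imp_coercive:
  fixes B :: "real mat"
  assumes B: "B \<in> carrier_mat n n" and sym: "transpose_mat B = B"
    and d: "Determinant.det B \<noteq> 0"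
    and psd: "\<And>x. x \<in> carrier_vec n \<Longrightarrow> 0 \<le> scalar_prod x (B *\<^sub>v x)"
  obtains e where "0 < e" "\<And>x. x \<in> carrier_vec n \<Longrightarrow> e * scalar_prod x x \<le> scalar_prod x (B *\<^sub>v x)"
proof -
  obtain C where C: "C \<in> carrier_mat n n" and BC: "B * C = 1\<^sub>m n"
    using inverse_mat_exists[OF B d] by blast
  define K where "K = 1 + (\<Sum>i<n. \<Sum>j<n. \<bar>C $$ (i,j)\<bar>)"
  have K: "0 < K" unfolding K_def by (smt (verit) sum_nonneg abs_ge_zero)
  have "1 / K * scalar_prod x x \<le> scalar_prod x (B *\<^sub>v x)" if x: "x \<in> carrier_vec n" for x
  proof -
    define y where "y = C *\<^sub>v x"
    define t where "t = 1 / K"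
    have y: "y \<in> carrier_vec n" using C x by (simp add: y_def)
    have By: "B *\<^sub>v y = x"
      unfolding y_def using B C BC x by (simp add: assoc_mult_mat_vec[symmetric])
    have Bx: "B *\<^sub>v x \<in> carrier_vec n" using B x by simp
    have ty: "t \<cdot>\<^sub>v y \<in> carrier_vec n" using y by simp
    have yx: "scalar_prod y x \<le> K * scalar_prod x x"
      using quadratic_form_le_sum_abs[OF C x] scalar_prod_self_nonneg[of x]
        comm_scalar_prod[OF x y]
      unfolding K_def y_def by (simp add: algebra_simps)
    have yBx: "scalar_prod y (B *\<^sub>v x) = scalar_prod x x"
      using symmetric_bilinear[OF B sym y x] By by simp
    have "0 \<le> scalar_prod (x - t \<cdot>\<^sub>v y) (B *\<^sub>v (x - t \<cdot>\<^sub>v y))"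
      using x y by (intro psd) auto
    also have "B *\<^sub>v (x - t \<cdot>\<^sub>v y) = B *\<^sub>v x - t \<cdot>\<^sub>v x"
      using B x y ty By by (simp add: mult_minus_distrib_mat_vec mult_mat_vec)
    also have "scalar_prod (x - t \<cdot>\<^sub>v y) (B *\<^sub>v x - t \<cdot>\<^sub>v x) =
        scalar_prod x (B *\<^sub>v x) - 2 * t * scalar_prod x x + t * t * scalar_prod y x"
      using x y ty Bx yBx
      by (simp add: minus_scalar_prod_distrib[of _ n] scalar_prod_minus_distrib[of _ n] algebra_simps)
    finally have "2 * t * scalar_prod x x - t * t * scalar_prod y x \<le> scalar_prod x (B *\<^sub>v x)" by simp
    moreover have "t * t * scalar_prod y x \<le> t * t * (K * scalar_prod x x)"
      by (intro mult_left_mono yx) simp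
    moreover have "t * t * (K * scalar_prod x x) = t * scalar_prod x x"
      using K by (simp add: t_def)
    ultimately show ?thesis by (simp add: t_def)
  qed
  moreover have "0 < 1 / K" using K by simp
  ultimately show ?thesis using that by blast
qed

lemma smult_mat_mult_vec:
  fixes A :: "real mat"
  assumes "A \<in> carrier_mat m n" "x \<in> carrier_vec n"
  shows "(c \<cdot>\<^sub>m A) *\<^sub>v x = c \<cdot>\<^sub>v (A *\<^sub>v x)"
  using assms by (intro eq_vecI) (auto simp: scalar_prod_def sum_distrib_left mult.assoc)

lemma char_matrix_form:
  fixes A :: "real mat"
  assumes A: "A \<in> carrier_mat n n" and x: "x \<in> carrier_vec n"
  shows "scalar_prod x (char_matrix A c *\<^sub>v x) = scalar_prod x (A *\<^sub>v x) - c * scalar_prod x x"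
proof -
  have "char_matrix A c *\<^sub>v x = A *\<^sub>v x + (- c) \<cdot>\<^sub>v x"
    unfolding char_matrix_def using A x
    by (simp add: add_mult_distrib_mat_vec[of _ n n] smult_mat_mult_vec[OF one_carrier_mat x])
  then show ?thesis using A x by (simp add: scalar_prod_add_distrib[of _ n])
qed

text \<open>
  Let $g$ be the largest number with $x^TAx\ge g|x|^2$ for all $x$. Then $A-gI$ is positive
  semidefinite. If it were regular, it would be coercive and $g$ could be increased; hence it is
  singular and $g$ is an eigenvalue.
\<close>

lemma symmetric_form_ge_eigenvalue_bound:
  fixes A :: "real mat"
  assumes A: "A \<in> carrier_mat n n" and sym: "transpose_mat A = A"
    and ev: "\<And>a. eigenvalue A a \<Longrightarrow> c \<le> a" and x: "x \<in> carrier_vec n"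
  shows "c * scalar_prod x x \<le> scalar_prod x (A *\<^sub>v x)"
proof (cases "x = 0\<^sub>v n")
  case True
  then show ?thesis using A by (simp add: scalar_prod_def)
next
  case False
  then have xx: "0 < scalar_prod x x"
    using scalar_prod_self_eq_0[OF x] scalar_prod_self_nonneg[of x] by simp
  \<comment> \<open>the lower bounds of the form on unit vectors\<close>
  define G where "G = {g. \<forall>y\<in>carrier_vec n. g * scalar_prod y y \<le> scalar_prod y (A *\<^sub>v y)}"
  have ne: "- (\<Sum>i<n. \<Sum>j<n. \<bar>A $$ (i,j)\<bar>) \<in> G"
    unfolding G_def using quadratic_form_le_sum_abs[OF A] by (fastforce simp: abs_le_iff)
  have bdd: "bdd_above G"
    by (rule bdd_aboveI[of _ "scalar_prod x (A *\<^sub>v x) / scalar_prod x x"])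
      (use xx x in \<open>auto simp: G_def pos_le_divide_eq\<close>)
  define g where "g = Sup G"
  have gG: "g \<in> G"
    unfolding G_def
  proof (intro CollectI ballI)
    fix y :: "real vec" assume y: "y \<in> carrier_vec n"
    have G0: "G \<noteq> {}" using ne by blast
    show "g * scalar_prod y y \<le> scalar_prod y (A *\<^sub>v y)"
    proof (cases "y = 0\<^sub>v n")
      case True
      then show ?thesis using A by (simp add: scalar_prod_def)
    next
      case False
      then have yy: "0 < scalar_prod y y"
        using scalar_prod_self_eq_0[OF y] scalar_prod_self_nonneg[of y] by simp
      have "g \<le> scalar_prod y (A *\<^sub>v y) / scalar_prod y y"
        unfolding g_def using yy y
        by (intro cSup_least) (rule G0, simp add: G_def pos_le_divide_eq)
      then show ?thesis using yy by (simp add: pos_le_divide_eq)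
    qed
  qed
  have "Determinant.det (char_matrix A g) = 0"
  proof (rule ccontr)
    assume d: "Determinant.det (char_matrix A g) \<noteq> 0"
    have B: "char_matrix A g \<in> carrier_mat n n" using A by simp
    have Bs: "transpose_mat (char_matrix A g) = char_matrix A g"
    proof (rule eq_matI)
      fix i j assume "i < dim_row (char_matrix A g)" "j < dim_col (char_matrix A g)"
      then have ij: "i < n" "j < n" using A by (auto simp: char_matrix_def)
      then have "A $$ (j, i) = A $$ (i, j)" using A sym by (metis carrier_matD index_transpose_mat(1))
      then show "transpose_mat (char_matrix A g) $$ (i, j) = char_matrix A g $$ (i, j)"
        using A ij by (auto simp: char_matrix_def)
    qed (use A in \<open>auto simp: char_matrix_def\<close>)
    have psd: "0 \<le> scalar_prod y (char_matrix A g *\<^sub>v y)" if "y \<in> carrier_vec n" for y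
      using gG that by (simp add: char_matrix_form[OF A] G_def)
    obtain e where e: "0 < e" and
      le: "\<And>y. y \<in> carrier_vec n \<Longrightarrow> e * scalar_prod y y \<le> scalar_prod y (char_matrix A g *\<^sub>v y)"
      using psd_regular_imp_coercive[OF B Bs d psd] by blast
    have "g + e \<in> G"
      unfolding G_def using le by (auto simp: char_matrix_form[OF A] algebra_simps)
    then have "g + e \<le> g" unfolding g_def using bdd by (intro cSup_upper)
    with e show False by simp
  qed
  then have "eigenvalue A g" by (simp add: eigenvalue_det[OF A])
  then have "c \<le> g" by (rule ev)
  then have "c * scalar_prod x x \<le> g * scalar_prod x x" using xx by (intro mult_right_mono) auto
  also have "\<dots> \<le> scalar_prod x (A *\<^sub>v x)" using gG x by (simp add: G_def)
  finally show ?thesis .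
qed

text \<open>
  The lower bound for $-A$.
\<close>

lemma symmetric_form_le_eigenvalue_bound:
  fixes A :: "real mat"
  assumes A: "A \<in> carrier_mat n n" and sym: "transpose_mat A = A"
    and ev: "\<And>a. eigenvalue A a \<Longrightarrow> a \<le> c" and x: "x \<in> carrier_vec n"
  shows "scalar_prod x (A *\<^sub>v x) \<le> c * scalar_prod x x"
proof -
  have nA: "- A \<in> carrier_mat n n" using A by simp
  have mv: "(- A) *\<^sub>v v = - (A *\<^sub>v v)" if "v \<in> carrier_vec n" for v
    using A that by (intro eq_vecI) (auto simp: scalar_prod_def sum_negf)
  have "transpose_mat (- A) = - A" using A sym by (metis transpose_uminus)
  moreover have "- c \<le> a" if a: "eigenvalue (- A) a" for a
  proof -
    obtain v where v: "v \<in> carrier_vec n" "v \<noteq> 0\<^sub>v n" "(- A) *\<^sub>v v = a \<cdot>\<^sub>v v"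
      using a nA unfolding eigenvalue_def eigenvector_def by (metis carrier_matD(1))
    have "A *\<^sub>v v = - ((- A) *\<^sub>v v)" unfolding mv[OF v(1)] using A v(1) by simp
    also have "\<dots> = (- a) \<cdot>\<^sub>v v" unfolding v(3) using v(1) by (intro eq_vecI) auto
    finally have "eigenvalue A (- a)"
      using v A unfolding eigenvalue_def eigenvector_def by auto
    from ev[OF this] show ?thesis by simp
  qed
  ultimately have "- c * scalar_prod x x \<le> scalar_prod x (- A *\<^sub>v x)"
    using x nA by (intro symmetric_form_ge_eigenvalue_bound) auto
  also have "\<dots> = - scalar_prod x (A *\<^sub>v x)"
    using A x by (simp add: mv)
  finally show ?thesis by simp
qed

text \<open>
  An eigenvalue $a$ of $S^2$ is nonnegative, as $v^TS^2v=|Sv|^2$. With $s=\sqrt a$ one has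
  $(S-s)(S+s)v=0$, so either $(S+s)v$ is an eigenvector of $S$ for $s$, or $v$ is one for $-s$;
  positivity of the spectrum of $S$ excludes the latter.
\<close>

lemma eigenvalue_square_symmetric:
  fixes S :: "real mat"
  assumes S: "S \<in> carrier_mat n n" and sym: "transpose_mat S = S"
    and ev: "\<And>a. eigenvalue S a \<Longrightarrow> l \<le> a \<and> a \<le> u" and l: "0 < l"
    and a: "eigenvalue (S * S) a"
  shows "l\<^sup>2 \<le> a \<and> a \<le> u\<^sup>2"
proof -
  obtain v where v: "v \<in> carrier_vec n" "v \<noteq> 0\<^sub>v n" "S * S *\<^sub>v v = a \<cdot>\<^sub>v v"
    using a S unfolding eigenvalue_def eigenvector_def by auto
  have Sv: "S *\<^sub>v v \<in> carrier_vec n" using S v by simp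
  have SSv: "S *\<^sub>v (S *\<^sub>v v) = a \<cdot>\<^sub>v v" using v S by (simp add: assoc_mult_mat_vec)
  have vv: "0 < scalar_prod v v"
    using scalar_prod_self_eq_0[OF v(1)] scalar_prod_self_nonneg[of v] v(2) by simp
  have "scalar_prod (S *\<^sub>v v) (S *\<^sub>v v) = a * scalar_prod v v"
    using symmetric_bilinear[OF S sym v(1) Sv] SSv v by simp
  then have "0 \<le> a" using scalar_prod_self_nonneg[of "S *\<^sub>v v"] vv by (simp add: zero_le_mult_iff)
  define s where "s = sqrt a"
  have s: "0 \<le> s" "s * s = a" using \<open>0 \<le> a\<close> by (auto simp: s_def)
  define w where "w = S *\<^sub>v v + s \<cdot>\<^sub>v v"
  have w: "w \<in> carrier_vec n" using Sv v by (simp add: w_def)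
  have "S *\<^sub>v w = a \<cdot>\<^sub>v v + s \<cdot>\<^sub>v (S *\<^sub>v v)"
    unfolding w_def using S v Sv by (simp add: mult_add_distrib_mat_vec mult_mat_vec SSv)
  also have "\<dots> = s \<cdot>\<^sub>v w"
    unfolding w_def using S v Sv s by (intro eq_vecI) (auto simp: algebra_simps)
  finally have Sw: "S *\<^sub>v w = s \<cdot>\<^sub>v w" .
  have "eigenvalue S s"
  proof (cases "w = 0\<^sub>v n")
    case True
    have "S *\<^sub>v v = (- s) \<cdot>\<^sub>v v"
    proof (rule eq_vecI)
      fix i assume "i < dim_vec ((- s) \<cdot>\<^sub>v v)"
      then have i: "i < n" using v by simp
      have "vec_index w i = 0" using True i by simp
      then show "vec_index (S *\<^sub>v v) i = vec_index ((- s) \<cdot>\<^sub>v v) i"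
        unfolding w_def using i S v Sv by simp
    qed (use S v in simp)
    then have "eigenvalue S (- s)" using v S unfolding eigenvalue_def eigenvector_def by auto
    from ev[OF this] l s show ?thesis by simp
  next
    case False
    then show ?thesis using w Sw S unfolding eigenvalue_def eigenvector_def by auto
  qed
  from ev[OF this] l have "l \<le> s" "s \<le> u" "0 < l" by auto
  then have "l * l \<le> s * s" "s * s \<le> u * u" by (auto intro!: mult_mono)
  then show ?thesis using s by (simp add: power2_eq_square)
qed

text \<open>
  What the definition of $\Theta$ implies for the inverse covariance matrix $W=(S^2)^{-1}$: the
  eigenvalues of $W$ are the inverses of those of $S^2$, and the form of a symmetric matrix lies between
  its extreme eigenvalues.
\<close>

lemma mat_inverse_square_symmetric:
  fixes S :: "real mat"
  assumes S: "S \<in> carrier_mat n n" and sym: "transpose_mat S = S"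
    and ev: "\<And>a. eigenvalue S a \<Longrightarrow> l \<le> a \<and> a \<le> u" and l: "0 < l"
  obtains W where "mat_inverse (S * S) = Some W" "W \<in> carrier_mat n n" "transpose_mat W = W"
    "Determinant.det (S * S) = 1 / Determinant.det W" "Determinant.det W \<noteq> 0"
    "\<And>x. x \<in> carrier_vec n \<Longrightarrow> scalar_prod x x / u\<^sup>2 \<le> scalar_prod x (W *\<^sub>v x)"
    "\<And>x. x \<in> carrier_vec n \<Longrightarrow> scalar_prod x (W *\<^sub>v x) \<le> scalar_prod x x / l\<^sup>2"
proof -
  have SS: "S * S \<in> carrier_mat n n" using S by simp
  have evSS: "l\<^sup>2 \<le> a \<and> a \<le> u\<^sup>2" if "eigenvalue (S * S) a" for a
    using eigenvalue_square_symmetric[OF S sym ev l that] .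
  have char0: "char_matrix (S * S) 0 = S * S"
    using S unfolding char_matrix_def by (intro eq_matI) auto
  have "\<not> eigenvalue (S * S) 0" using evSS[of 0] l by (auto simp: power2_eq_square mult_le_0_iff)
  then have d: "Determinant.det (S * S) \<noteq> 0" unfolding eigenvalue_det[OF SS] char0 .
  then obtain W where mi: "mat_inverse (S * S) = Some W"
    using det_non_zero_imp_unit[OF SS d, of n] mat_inverse(1)[OF SS, of n] by (metis not_None_eq)
  have W: "S * S * W = 1\<^sub>m n" "W * (S * S) = 1\<^sub>m n" "W \<in> carrier_mat n n"
    using mat_inverse(2)[OF SS mi] by auto
  have dd: "Determinant.det (S * S) * Determinant.det W = 1"
    using det_mult[OF SS W(3)] W(1) by simp
  have tSS: "transpose_mat (S * S) = S * S" using S sym by (simp add: transpose_mult[of _ n n])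
  have tW: "transpose_mat W = W"
  proof -
    have "transpose_mat W * (S * S) = 1\<^sub>m n"
      using transpose_mult[OF SS W(3)] W(1) tSS by simp
    then have "transpose_mat W * (S * S) * W = W" using W by simp
    moreover have "transpose_mat W * (S * S) * W = transpose_mat W * (S * S * W)"
      using W SS by (intro assoc_mult_mat[of _ n n _ n _ n]) auto
    ultimately show ?thesis using W by simp
  qed
  have evW: "1 / u\<^sup>2 \<le> a \<and> a \<le> 1 / l\<^sup>2" if a: "eigenvalue W a" for a
  proof -
    obtain v where v: "v \<in> carrier_vec n" "v \<noteq> 0\<^sub>v n" "W *\<^sub>v v = a \<cdot>\<^sub>v v"
      using a W unfolding eigenvalue_def eigenvector_def by auto
    have "v = S * S *\<^sub>v (W *\<^sub>v v)"
      using W SS v(1) by (simp add: assoc_mult_mat_vec[OF SS W(3) v(1), symmetric])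
    also have "\<dots> = a \<cdot>\<^sub>v (S * S *\<^sub>v v)" unfolding v(3) using SS v by (simp add: mult_mat_vec)
    finally have eq: "v = a \<cdot>\<^sub>v (S * S *\<^sub>v v)" .
    have "a \<noteq> 0"
    proof
      assume "a = 0"
      with eq have "v = 0 \<cdot>\<^sub>v (S * S *\<^sub>v v)" by simp
      also have "\<dots> = 0\<^sub>v n" using SS v by (intro eq_vecI) auto
      finally show False using v by simp
    qed
    have "S * S *\<^sub>v v = (1 / a) \<cdot>\<^sub>v v"
      using \<open>a \<noteq> 0\<close> SS by (subst (2) eq) (auto simp: smult_smult_assoc)
    then have "eigenvalue (S * S) (1 / a)"
      using v SS unfolding eigenvalue_def eigenvector_def by (metis carrier_matD(1))
    from evSS[OF this] have b: "l\<^sup>2 \<le> 1 / a" "1 / a \<le> u\<^sup>2" by auto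
    have l2: "0 < l\<^sup>2" using l by simp
    with b(1) have "0 < a" by (metis less_le_trans zero_less_divide_1_iff)
    have "0 < u\<^sup>2" using l2 b by linarith
    then show ?thesis using b \<open>0 < a\<close> l2 by (simp add: field_simps)
  qed
  show ?thesis
  proof (rule that[OF mi W(3) tW])
    show "Determinant.det W \<noteq> 0" using dd by auto
    then show "Determinant.det (S * S) = 1 / Determinant.det W"
      using dd by (simp add: eq_divide_eq)
    fix x :: "real vec" assume x: "x \<in> carrier_vec n"
    show "scalar_prod x x / u\<^sup>2 \<le> scalar_prod x (W *\<^sub>v x)"
      using symmetric_form_ge_eigenvalue_bound[OF W(3) tW _ x, of "1 / u\<^sup>2"] evW by auto
    show "scalar_prod x (W *\<^sub>v x) \<le> scalar_prod x x / l\<^sup>2"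
      using symmetric_form_le_eigenvalue_bound[OF W(3) tW _ x, of "1 / l\<^sup>2"] evW by auto
  qed
qed

section \<open>Logarithms of Gaussian densities as quadratic polynomials\<close>

abbreviation sum_sq :: "nat \<Rightarrow> (nat \<Rightarrow> real) \<Rightarrow> real" where
  "sum_sq n x \<equiv> \<Sum>i<n. (x i)\<^sup>2"

lemma nn_integral_isotropic_gaussian:
  assumes l: "0 < (l::real)"
  shows "(\<integral>\<^sup>+x. ennreal (exp (- (l * sum_sq n x) / 2)) \<partial>PiM {..<n} (\<lambda>_. lborel)) =
    ennreal (sqrt ((2 * pi) ^ n / l ^ n))"
proof -
  define w where "w = (\<lambda>i j::nat. if i = j then l else 0)"
  have q: "quad n w x = l * sum_sq n x" for x
  proof -
    have "quad n w x = (\<Sum>i<n. \<Sum>j<n. if i = j then l * x i * x i else 0)"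
      unfolding quad_def w_def by (intro sum.cong) auto
    then show ?thesis by (simp add: sum_distrib_left power2_eq_square mult_ac)
  qed
  have pd: "0 < quad n w x" if "\<exists>i<n. x i \<noteq> 0" for x
    unfolding q using that l by (intro mult_pos_pos) (auto intro!: sum_pos2)
  have "Matrix.mat n n (\<lambda>(i,j). w i j) = l \<cdot>\<^sub>m 1\<^sub>m n"
    by (rule eq_matI) (auto simp: w_def)
  then have "Determinant.det (Matrix.mat n n (\<lambda>(i,j). w i j)) = l ^ n" by simp
  moreover have "w i j = w j i" for i j by (simp add: w_def)
  ultimately show ?thesis
    using det_pos_and_nn_integral_gaussian[of n w "\<lambda>_. 0", OF _ pd] by (simp add: q)
qed

text \<open>
  The determinant is read off from the Gaussian integral of the form, which is monotone in the form;
  the comparison forms are multiples of $|x|^2$.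
\<close>

lemma det_bounds_of_form_bounds:
  assumes sym: "\<And>i j. i < n \<Longrightarrow> j < n \<Longrightarrow> w i j = w j i" and p: "0 < p"
    and lower: "\<And>x. p * sum_sq n x \<le> quad n w x" and upper: "\<And>x. quad n w x \<le> q * sum_sq n x"
  shows "p ^ n \<le> Determinant.det (Matrix.mat n n (\<lambda>(i,j). w i j))"
    and "0 < q \<Longrightarrow> Determinant.det (Matrix.mat n n (\<lambda>(i,j). w i j)) \<le> q ^ n"
proof -
  define d where "d = Determinant.det (Matrix.mat n n (\<lambda>(i,j). w i j))"
  define I where "I = (\<integral>\<^sup>+x. ennreal (exp (- quad n w x / 2)) \<partial>PiM {..<n} (\<lambda>_. lborel))"
  have pd: "0 < quad n w x" if "\<exists>i<n. x i \<noteq> 0" for x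
  proof -
    have "0 < p * sum_sq n x" using that p by (intro mult_pos_pos) (auto intro!: sum_pos2)
    then show ?thesis using lower[of x] by simp
  qed
  have d: "0 < d" and I: "I = ennreal (sqrt ((2 * pi) ^ n / d))"
    using det_pos_and_nn_integral_gaussian[of n w "\<lambda>_. 0", OF sym pd] unfolding d_def I_def by auto
  have "I \<le> ennreal (sqrt ((2 * pi) ^ n / p ^ n))"
    unfolding I_def nn_integral_isotropic_gaussian[OF p, symmetric]
    using lower by (intro nn_integral_mono ennreal_leI) auto
  then have "(2 * pi) ^ n / d \<le> (2 * pi) ^ n / p ^ n" unfolding I using d p by simp
  then show "p ^ n \<le> d" using d p by (simp add: field_simps)
  assume q: "0 < q"
  have "ennreal (sqrt ((2 * pi) ^ n / q ^ n)) \<le> I"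
    unfolding I_def nn_integral_isotropic_gaussian[OF q, symmetric]
    using upper by (intro nn_integral_mono ennreal_leI) auto
  then have "(2 * pi) ^ n / q ^ n \<le> (2 * pi) ^ n / d" unfolding I using d q by simp
  then show "d \<le> q ^ n" using d q by (simp add: field_simps)
qed

lemma sum_mult_delta:
  fixes f :: "nat \<Rightarrow> real"
  assumes "i < n"
  shows "(\<Sum>t<n. f t * (if t = i then s else 0)) = f i * s"
proof -
  have "(\<Sum>t<n. f t * (if t = i then s else 0)) = (\<Sum>t<n. if t = i then f t * s else 0)"
    by (intro sum.cong) auto
  then show ?thesis using assms by simp
qed

lemma quad_two_coordinates:
  assumes "i < n" "j < n"
  shows "quad n w (\<lambda>t. (if t = i then s else 0) + (if t = j then u else 0)) =
    w i i * s\<^sup>2 + w i j * s * u + w j i * s * u + w j j * u\<^sup>2"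
proof -
  define e where "e t = (if t = i then s else 0) + (if t = j then u else 0)" for t
  have inner: "(\<Sum>t<n. f t * e t) = f i * s + f j * u" for f
    unfolding e_def using assms by (simp add: distrib_left sum.distrib sum_mult_delta)
  have "quad n w e = (\<Sum>p<n. (\<Sum>t<n. w p t * e t) * e p)"
    unfolding quad_def by (simp add: sum_distrib_left mult_ac)
  then show ?thesis
    unfolding inner e_def[symmetric] by (simp add: algebra_simps power2_eq_square)
qed

text \<open>
  Polarization: evaluate the form at $e_i+e_j$ and at $e_i-e_j$.
\<close>

lemma entry_bound_of_form_bounds:
  assumes sym: "\<And>i j. i < n \<Longrightarrow> j < n \<Longrightarrow> w i j = w j i"
    and lower: "\<And>x. 0 \<le> quad n w x" and upper: "\<And>x. quad n w x \<le> q * sum_sq n x"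
    and ij: "i < n" "j < n"
  shows "\<bar>w i j\<bar> \<le> q"
proof -
  define e where "e = (\<lambda>u t. (if t = i then 1 else 0) + (if t = j then u else (0::real)))"
  have eq: "quad n w (e u) = w i i + 2 * w i j * u + w j j * u\<^sup>2" for u
    unfolding e_def quad_two_coordinates[OF ij] using sym[OF ij] by simp
  have diag: "w t t \<le> q \<and> 0 \<le> w t t" if "t < n" for t
    using upper[of "\<lambda>s. (if s = t then 1 else 0) + (if s = t then 0 else 0)"]
      lower[of "\<lambda>s. (if s = t then 1 else 0) + (if s = t then 0 else 0)"]
      quad_two_coordinates[OF that that, of w 1 0] that
    by (simp add: if_distrib[of "\<lambda>x. x\<^sup>2"] cong: if_cong)
  show ?thesis
    using lower[of "e 1"] lower[of "e (-1)"] diag[OF ij(1)] diag[OF ij(2)] unfolding eq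
    by (simp add: abs_le_iff)
qed

text \<open>
  A constant coordinate with index \<open>k\<close> is appended, so that every polynomial of degree two in
  $x/\rho$ becomes a quadratic form.
\<close>

definition homogenize :: "nat \<Rightarrow> real \<Rightarrow> (nat \<Rightarrow> real) \<Rightarrow> nat \<Rightarrow> real" where
  "homogenize k \<rho> x i = (if i < k then x i / \<rho> else 1)"

lemma quad_minus:
  assumes sym: "\<And>i j. i < n \<Longrightarrow> j < n \<Longrightarrow> w i j = w j i"
  shows "quad n w (\<lambda>i. x i - m i) = quad n w x - 2 * (\<Sum>i<n. (\<Sum>j<n. w i j * m j) * x i) + quad n w m"
proof -
  have "(\<Sum>i<n. \<Sum>j<n. w i j * m i * x j) = (\<Sum>j<n. \<Sum>i<n. w i j * m i * x j)"
    by (rule sum.swap)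
  also have "\<dots> = (\<Sum>i<n. \<Sum>j<n. w i j * x i * m j)"
    by (intro sum.cong refl) (auto simp: sym mult_ac)
  finally have "(\<Sum>i<n. \<Sum>j<n. w i j * m i * x j) = (\<Sum>i<n. \<Sum>j<n. w i j * x i * m j)" .
  moreover have "(\<Sum>i<n. (\<Sum>j<n. w i j * m j) * x i) = (\<Sum>i<n. \<Sum>j<n. w i j * x i * m j)"
    by (simp add: sum_distrib_left sum_distrib_right mult_ac)
  ultimately show ?thesis
    unfolding quad_def by (simp add: algebra_simps sum.distrib sum_subtractf)
qed

locale gaussian_setting =
  fixes k :: nat and r \<rho>l \<rho>u b :: real
  assumes k: "1 \<le> k" and r: "0 < r" and \<rho>l: "0 < \<rho>l" and \<rho>lu: "\<rho>l < \<rho>u"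
    and b_def: "b = r\<^sup>2 / (2 * \<rho>u\<^sup>2) + real k * ln (sqrt 2 * \<rho>u / \<rho>l)"
begin

lemma \<rho>u: "0 < \<rho>u" using \<rho>l \<rho>lu by simp

text \<open>
  The factor $\sqrt2$ alone keeps the logarithm away from $0$. This is why $k=O(b)$.
\<close>

lemma ln_ratio_ge: "1 / 3 \<le> ln (sqrt 2 * \<rho>u / \<rho>l)"
proof -
  have "ln (sqrt 2 * \<rho>u / \<rho>l) = ln 2 / 2 + ln (\<rho>u / \<rho>l)"
    using \<rho>l \<rho>u by (simp add: ln_mult ln_div ln_sqrt)
  moreover have "0 \<le> ln (\<rho>u / \<rho>l)" using \<rho>l \<rho>lu by simp
  ultimately show ?thesis using ln2_ge_two_thirds by simp
qed

lemma k_le: "real k \<le> 3 * b"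
proof -
  define X where "X = real k * ln (sqrt 2 * \<rho>u / \<rho>l)"
  have "real k * (1 / 3) \<le> X"
    unfolding X_def by (intro mult_left_mono ln_ratio_ge) simp
  then have "real k \<le> 3 * X" by simp
  moreover define Z where "Z = r\<^sup>2 / (2 * \<rho>u\<^sup>2)"
  moreover have "0 \<le> Z" unfolding Z_def by simp
  ultimately show ?thesis unfolding b_def X_def[symmetric] Z_def[symmetric] by simp
qed

lemma b_ge: "1 / 3 \<le> b" using k_le k by simp

lemma scaled_radius_le: "(r / \<rho>u)\<^sup>2 \<le> 2 * b"
proof -
  have "0 \<le> real k * ln (sqrt 2 * \<rho>u / \<rho>l)"
    using ln_ratio_ge by (intro mult_nonneg_nonneg) auto
  then show ?thesis unfolding b_def by (simp add: power_divide)
qed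

lemma ratio_le: "\<rho>u / \<rho>l \<le> exp b"
proof -
  have "\<rho>u / \<rho>l \<le> sqrt 2 * \<rho>u / \<rho>l" using \<rho>u \<rho>l by (simp add: field_simps)
  also have "\<dots> = exp (ln (sqrt 2 * \<rho>u / \<rho>l))" using \<rho>u \<rho>l by simp
  also have "ln (sqrt 2 * \<rho>u / \<rho>l) \<le> real k * ln (sqrt 2 * \<rho>u / \<rho>l)"
    using k ln_ratio_ge by (simp add: mult_le_cancel_right1)
  also have "\<dots> \<le> b" unfolding b_def by simp
  finally show ?thesis by simp
qed

lemma le_exp: "(x::real) \<le> exp x"
  using exp_ge_add_one_self[of x] by linarith

text \<open>
  The logarithm of $d\mathcal N(m,W^{-1})/d\mu$ is $|x|^2/(4\overline\rho^2)-(x-m)^TW(x-m)/2$ plus half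
  the logarithm of $(2\overline\rho^2)^k\det W$. Its coefficients are controlled through the entries and
  the determinant of $W$. The upper bound $b$ holds pointwise because the form is at least
  $|x-m|^2/\overline\rho^2$ and $|x|^2/4-|x-m|^2/2=|m|^2/2-|x/2-m|^2$.
\<close>

lemma log_quadratic:
  fixes w :: "nat \<Rightarrow> nat \<Rightarrow> real" and m :: "nat \<Rightarrow> real"
  defines "d \<equiv> Determinant.det (Matrix.mat k k (\<lambda>(i,j). w i j))"
  assumes sym: "\<And>i j. i < k \<Longrightarrow> j < k \<Longrightarrow> w i j = w j i"
    and lower: "\<And>x. sum_sq k x / \<rho>u\<^sup>2 \<le> quad k w x"
    and upper: "\<And>x. quad k w x \<le> sum_sq k x / \<rho>l\<^sup>2"
    and m: "sum_sq k m \<le> r\<^sup>2"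
  obtains c where "\<And>i j. i \<le> k \<Longrightarrow> j \<le> k \<Longrightarrow> \<bar>c i j\<bar> \<le> exp (8 * b)"
    "\<And>x. sqrt ((2 * \<rho>u\<^sup>2) ^ k * d) * exp (sum_sq k x / (4 * \<rho>u\<^sup>2) - quad k w (\<lambda>i. x i - m i) / 2) =
      exp (quad (Suc k) c (homogenize k \<rho>u x))"
    "\<And>x. quad (Suc k) c (homogenize k \<rho>u x) \<le> b"
proof -
  define q where "q = sqrt ((2 * \<rho>u\<^sup>2) ^ k * d)"
  define \<alpha> where "\<alpha> = ln q - quad k w m / 2"
  define B where "B i = (\<Sum>j<k. w i j * m j)" for i
  define c where "c i j = (if i < k then if j < k then (if i = j then 1 / 4 else 0) - \<rho>u\<^sup>2 * w i j / 2
      else \<rho>u * B i else if j < k then 0 else \<alpha>)" for i j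
  define K where "K = \<rho>u / \<rho>l"
  define a where "a = r / \<rho>u"
  have K: "1 \<le> K" "K \<le> exp b" unfolding K_def using \<rho>l \<rho>lu ratio_le by auto
  have K2: "K\<^sup>2 \<le> exp (2 * b)"
    using K by (simp add: exp_double power_mono)
  have a: "0 < a" "a\<^sup>2 \<le> 2 * b" unfolding a_def using r \<rho>u scaled_radius_le by auto
  have bb: "1 / 3 \<le> b" by (rule b_ge)
  have upper': "quad k w x \<le> 1 / \<rho>l\<^sup>2 * sum_sq k x" for x using upper[of x] by simp
  have lower': "1 / \<rho>u\<^sup>2 * sum_sq k x \<le> quad k w x" for x using lower[of x] by simp
  have nonneg: "0 \<le> quad k w x" for x
    using lower[of x] sum_nonneg[of "{..<k}" "\<lambda>i. (x i)\<^sup>2"] by (smt (verit) divide_nonneg_nonneg zero_le_power2)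
  have d: "(1 / \<rho>u\<^sup>2) ^ k \<le> d" "d \<le> (1 / \<rho>l\<^sup>2) ^ k"
    unfolding d_def using \<rho>u \<rho>l
    by (auto intro!: det_bounds_of_form_bounds[OF sym _ lower' upper'])
  have "1 \<le> (2 * \<rho>u\<^sup>2) ^ k * (1 / \<rho>u\<^sup>2) ^ k"
    using \<rho>u by (subst power_mult_distrib[symmetric]) simp
  also have "\<dots> \<le> (2 * \<rho>u\<^sup>2) ^ k * d" using d(1) by (intro mult_left_mono) auto
  finally have q1: "1 \<le> q" unfolding q_def by simp
  have "q \<le> sqrt ((2 * \<rho>u\<^sup>2) ^ k * (1 / \<rho>l\<^sup>2) ^ k)"
    unfolding q_def using d(2) by (intro real_sqrt_le_mono mult_left_mono) auto
  also have "(2 * \<rho>u\<^sup>2) ^ k * (1 / \<rho>l\<^sup>2) ^ k = ((sqrt 2 * \<rho>u / \<rho>l)\<^sup>2) ^ k"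
    by (subst power_mult_distrib[symmetric]) (simp add: power_mult_distrib power_divide)
  also have "\<dots> = ((sqrt 2 * \<rho>u / \<rho>l) ^ k)\<^sup>2" by (simp only: power_mult[symmetric] mult.commute)
  also have "sqrt \<dots> = (sqrt 2 * \<rho>u / \<rho>l) ^ k" using \<rho>u \<rho>l by simp
  finally have "ln q \<le> ln ((sqrt 2 * \<rho>u / \<rho>l) ^ k)" using q1 by simp
  also have "\<dots> = real k * ln (sqrt 2 * \<rho>u / \<rho>l)" by (rule ln_realpow)
  finally have lnq: "ln q \<le> b - a\<^sup>2 / 2" unfolding b_def a_def by (simp add: power_divide)
  have lnq0: "0 \<le> ln q" using q1 by simp
  have wb: "\<bar>w i j\<bar> \<le> 1 / \<rho>l\<^sup>2" if "i < k" "j < k" for i j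
    by (rule entry_bound_of_form_bounds[OF sym nonneg upper' that])
  have mb: "\<bar>m j\<bar> \<le> r" if "j < k" for j
  proof -
    have "(m j)\<^sup>2 \<le> sum_sq k m" using that by (intro member_le_sum) auto
    with m have "(m j)\<^sup>2 \<le> r\<^sup>2" by simp
    then show ?thesis using r by (simp add: abs_le_square_iff[symmetric])
  qed
  have quad_c: "quad (Suc k) c (homogenize k \<rho>u x) =
      sum_sq k x / (4 * \<rho>u\<^sup>2) - quad k w (\<lambda>i. x i - m i) / 2 + ln q" for x
  proof -
    have "quad (Suc k) c (homogenize k \<rho>u x) =
      (\<Sum>i<k. \<Sum>j<k. c i j * (x i / \<rho>u) * (x j / \<rho>u)) + (\<Sum>i<k. c i k * (x i / \<rho>u)) + \<alpha>"
      unfolding quad_def by (simp add: sum.distrib homogenize_def c_def)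
    also have "(\<Sum>i<k. c i k * (x i / \<rho>u)) = (\<Sum>i<k. B i * x i)"
      using \<rho>u by (intro sum.cong) (auto simp: c_def)
    also have "(\<Sum>i<k. \<Sum>j<k. c i j * (x i / \<rho>u) * (x j / \<rho>u)) =
      (\<Sum>i<k. \<Sum>j<k. (if i = j then x i * x i / (4 * \<rho>u\<^sup>2) else 0) - w i j * x i * x j / 2)"
      using \<rho>u by (intro sum.cong) (auto simp: c_def field_simps power2_eq_square)
    also have "\<dots> = sum_sq k x / (4 * \<rho>u\<^sup>2) - quad k w x / 2"
      unfolding quad_def by (simp add: sum_subtractf sum_divide_distrib power2_eq_square)
    finally show ?thesis
      using quad_minus[of k w x m, OF sym] unfolding \<alpha>_def B_def by (simp add: algebra_simps)
  qed
  have alpha: "\<bar>\<alpha>\<bar> \<le> exp (8 * b)"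
  proof -
    have "quad k w m \<le> sum_sq k m / \<rho>l\<^sup>2" by (rule upper)
    also have "\<dots> \<le> r\<^sup>2 / \<rho>l\<^sup>2" using m by (intro divide_right_mono) auto
    also have "\<dots> = K\<^sup>2 * a\<^sup>2" unfolding K_def a_def using \<rho>u by (simp add: power_divide)
    also have "\<dots> \<le> exp (2 * b) * (2 * b)" using K2 a bb by (intro mult_mono) auto
    finally have qm: "quad k w m \<le> exp (2 * b) * (2 * b)" .
    have "ln q \<le> b" using lnq zero_le_power2[of a] by linarith
    moreover have "quad k w m / 2 \<le> exp (2 * b) * b" using qm by simp
    ultimately have "\<bar>\<alpha>\<bar> \<le> b + exp (2 * b) * b"
      unfolding \<alpha>_def using nonneg[of m] lnq0 bb by linarith
    also have "\<dots> \<le> exp (2 * b) * b + exp (2 * b) * b" using bb by (simp add: mult_le_cancel_right1)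
    also have "\<dots> = exp (2 * b) * (2 * b)" by simp
    also have "\<dots> \<le> exp (2 * b) * exp (2 * b)" by (intro mult_left_mono le_exp) simp
    also have "\<dots> \<le> exp (8 * b)" using bb by (simp add: exp_add[symmetric])
    finally show ?thesis .
  qed
  have beta: "\<bar>\<rho>u * B i\<bar> \<le> exp (8 * b)" if i: "i < k" for i
  proof -
    have "\<bar>B i\<bar> \<le> (\<Sum>j<k. \<bar>w i j * m j\<bar>)" unfolding B_def by (rule sum_abs)
    also have "\<dots> \<le> (\<Sum>j<k. 1 / \<rho>l\<^sup>2 * r)"
      unfolding abs_mult using wb[OF i] mb r by (intro sum_mono mult_mono) auto
    finally have "\<bar>B i\<bar> \<le> real k * (r / \<rho>l\<^sup>2)" by simp
    then have "\<bar>\<rho>u * B i\<bar> \<le> \<rho>u * (real k * (r / \<rho>l\<^sup>2))"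
      unfolding abs_mult using \<rho>u by (intro mult_mono) auto
    also have "\<dots> = real k * a * K\<^sup>2"
      unfolding a_def K_def using \<rho>u by (simp add: field_simps power2_eq_square)
    also have "\<dots> \<le> exp (3 * b) * exp (2 * b) * exp (2 * b)"
    proof (intro mult_mono K2)
      show "real k \<le> exp (3 * b)" using k_le le_exp[of "3 * b"] by simp
      have "2 * a \<le> 1 + a\<^sup>2" using sum_squares_bound[of 1 a] by simp
      then have "a \<le> 1 + 2 * b" using a by linarith
      then show "a \<le> exp (2 * b)" using exp_ge_add_one_self[of "2 * b"] by linarith
    qed (use a in auto)
    also have "\<dots> \<le> exp (8 * b)" using bb by (simp add: exp_add[symmetric])
    finally show ?thesis .
  qed
  have gamma: "\<bar>(if i = j then 1 / 4 else 0) - \<rho>u\<^sup>2 * w i j / 2\<bar> \<le> exp (8 * b)" if ij: "i < k" "j < k" for i j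
  proof -
    have "\<bar>(if i = j then 1 / 4 else 0) - \<rho>u\<^sup>2 * w i j / 2\<bar> \<le> 1 / 4 + \<rho>u\<^sup>2 * \<bar>w i j\<bar> / 2"
      using abs_triangle_ineq4[of "if i = j then 1 / 4 else 0" "\<rho>u\<^sup>2 * w i j / 2"]
      by (auto simp: abs_mult)
    also have "\<rho>u\<^sup>2 * \<bar>w i j\<bar> \<le> \<rho>u\<^sup>2 * (1 / \<rho>l\<^sup>2)" using wb[OF ij] by (intro mult_left_mono) auto
    also have "\<dots> = K\<^sup>2" unfolding K_def by (simp add: power_divide)
    finally have "\<bar>(if i = j then 1 / 4 else 0) - \<rho>u\<^sup>2 * w i j / 2\<bar> \<le> 1 / 4 + K\<^sup>2 / 2" by simp
    also have "\<dots> \<le> K\<^sup>2" using one_le_power[OF K(1), of 2] by simp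
    also have "\<dots> \<le> exp (8 * b)" by (rule order_trans[OF K2]) (use bb in simp)
    finally show ?thesis .
  qed
  show ?thesis
  proof (rule that[of c])
    show "\<bar>c i j\<bar> \<le> exp (8 * b)" if "i \<le> k" "j \<le> k" for i j
      unfolding c_def using alpha beta gamma by auto
    show "sqrt ((2 * \<rho>u\<^sup>2) ^ k * d) * exp (sum_sq k x / (4 * \<rho>u\<^sup>2) - quad k w (\<lambda>i. x i - m i) / 2) =
      exp (quad (Suc k) c (homogenize k \<rho>u x))" for x
      unfolding quad_c q_def[symmetric] exp_add using q1 by simp
    show "quad (Suc k) c (homogenize k \<rho>u x) \<le> b" for x
    proof -
      have "sum_sq k x / 4 - sum_sq k (\<lambda>i. x i - m i) / 2 \<le> (\<Sum>i<k. (m i)\<^sup>2 / 2)"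
        unfolding sum_divide_distrib sum_subtractf[symmetric]
      proof (rule sum_mono)
        fix i
        have "0 \<le> (x i / 2 - m i)\<^sup>2" by simp
        then show "(x i)\<^sup>2 / 4 - (x i - m i)\<^sup>2 / 2 \<le> (m i)\<^sup>2 / 2"
          by (simp add: power2_eq_square algebra_simps add_divide_distrib diff_divide_distrib)
      qed
      also have "\<dots> \<le> r\<^sup>2 / 2" using m by (simp add: sum_divide_distrib[symmetric])
      finally have "(sum_sq k x / 4 - sum_sq k (\<lambda>i. x i - m i) / 2) / \<rho>u\<^sup>2 \<le> r\<^sup>2 / 2 / \<rho>u\<^sup>2"
        by (intro divide_right_mono) auto
      moreover have "r\<^sup>2 / 2 / \<rho>u\<^sup>2 = a\<^sup>2 / 2" by (simp add: a_def power_divide)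
      ultimately show ?thesis
        unfolding quad_c using lower[of "\<lambda>i. x i - m i"] lnq by (simp add: diff_divide_distrib)
    qed
  qed
qed

end

section \<open>Gaussian densities with respect to the base measure\<close>

lemma gaussian_lebesgue_density_eq_quad:
  assumes W: "mat_inverse V = Some W" "W \<in> carrier_mat k k" and m: "m \<in> carrier_vec k"
  shows "gaussian_lebesgue_density k m V x =
    exp (- quad k (\<lambda>i j. W $$ (i,j)) (\<lambda>i. x i - vec_index m i) / 2) / sqrt ((2 * pi) ^ k * Determinant.det V)"
proof -
  define z where "z = Matrix.vec k x - m"
  have z: "z \<in> carrier_vec k" using m by (simp add: z_def)
  have "scalar_prod z (W *\<^sub>v z) = quad k (\<lambda>i j. W $$ (i,j)) (\<lambda>i. x i - vec_index m i)"
    unfolding quadratic_form_eq_sum[OF W(2) z] quad_def using m by (intro sum.cong) (auto simp: z_def)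
  then show ?thesis
    unfolding gaussian_lebesgue_density_def z_def[symmetric] Let_def by (simp add: W)
qed

lemma quad_eq_quadratic_form:
  assumes "W \<in> carrier_mat k k"
  shows "quad k (\<lambda>i j. W $$ (i,j)) x = scalar_prod (Matrix.vec k x) (W *\<^sub>v Matrix.vec k x)"
  unfolding quadratic_form_eq_sum[OF assms vec_carrier] quad_def by simp

lemma sum_sq_eq_scalar_prod: "sum_sq k x = scalar_prod (Matrix.vec k x) (Matrix.vec k x)"
  by (simp add: scalar_prod_def power2_eq_square lessThan_atLeast0)

definition base_density :: "nat \<Rightarrow> real \<Rightarrow> (nat \<Rightarrow> real) \<Rightarrow> real" where
  "base_density k \<rho> x = exp (- sum_sq k x / (4 * \<rho>\<^sup>2)) / sqrt ((2 * pi) ^ k * (2 * \<rho>\<^sup>2) ^ k)"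

lemma homogenize_measurable [measurable]:
  "(\<lambda>x. homogenize k \<rho> x i) \<in> borel_measurable (PiM {..<k} (\<lambda>_. lborel))"
  unfolding homogenize_def by (cases "i < k") auto

lemma quad_measurable [measurable]:
  assumes [measurable]: "\<And>i. (\<lambda>x. f x i) \<in> borel_measurable M"
  shows "(\<lambda>x. quad n w (f x)) \<in> borel_measurable M"
  unfolding quad_def by measurable

lemma base_measure_eq:
  assumes \<rho>: "0 < \<rho>"
  shows "base_measure k \<rho> = density (PiM {..<k} (\<lambda>_. lborel)) (\<lambda>x. ennreal (base_density k \<rho> x))"
proof -
  define v where "v = 2 * \<rho>\<^sup>2"
  have v: "0 < v" using \<rho> by (simp add: v_def)
  let ?V = "v \<cdot>\<^sub>m 1\<^sub>m k :: real mat"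
  have V: "?V \<in> carrier_mat k k" by simp
  have det: "Determinant.det ?V = v ^ k" by simp
  then obtain W where mi: "mat_inverse ?V = Some W"
    using det_non_zero_imp_unit[OF V, of k] v mat_inverse(1)[OF V, of k]
    by (metis not_None_eq power_not_zero less_irrefl)
  have W: "?V * W = 1\<^sub>m k" "W \<in> carrier_mat k k" using mat_inverse(2)[OF V mi] by auto
  have "v \<cdot>\<^sub>m W = 1\<^sub>m k" using W by (metis mult_smult_assoc_mat left_mult_one_mat one_carrier_mat)
  then have Wij: "v * W $$ (i,j) = (if i = j then 1 else 0)" if "i < k" "j < k" for i j
    using that W(2) by (metis carrier_matD index_one_mat(1) index_smult_mat(1))
  have quadW: "quad k (\<lambda>i j. W $$ (i,j)) x = sum_sq k x / v" for x
  proof -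
    have "W $$ (i,j) = (if i = j then 1 / v else 0)" if "i < k" "j < k" for i j
      using Wij[OF that] v by (auto simp: field_simps)
    then have "quad k (\<lambda>i j. W $$ (i,j)) x = (\<Sum>i<k. \<Sum>j<k. if i = j then x i * x i / v else 0)"
      unfolding quad_def by (intro sum.cong) auto
    then show ?thesis by (simp add: sum_divide_distrib power2_eq_square)
  qed
  have "gaussian_lebesgue_density k (0\<^sub>v k) ?V x = base_density k \<rho> x" for x
  proof -
    have "quad k (\<lambda>i j. W $$ (i,j)) (\<lambda>i. x i - vec_index (0\<^sub>v k) i) = sum_sq k x / v"
      unfolding quadW[symmetric] by (rule quad_cong) simp
    then show ?thesis
      unfolding gaussian_lebesgue_density_eq_quad[OF mi W(2) zero_carrier_vec] base_density_def det
      by (simp add: v_def)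
  qed
  then show ?thesis
    unfolding base_measure_def gaussian_def v_def by simp
qed

lemma base_density_pos: "0 < \<rho> \<Longrightarrow> 0 < base_density k \<rho> x"
  unfolding base_density_def by simp

lemma base_density_measurable [measurable]:
  "base_density k \<rho> \<in> borel_measurable (PiM {..<k} (\<lambda>_. lborel))"
  unfolding base_density_def[abs_def] by measurable

text \<open>
  For $t=0$ this is the total mass of the base measure; for $t=1/8$ it bounds all moments of
  $|x|/\rho$ that are needed.
\<close>

lemma nn_integral_base_measure_exp:
  assumes \<rho>: "0 < \<rho>" and t: "t < 1 / 4"
  shows "(\<integral>\<^sup>+x. ennreal (exp (t * (sum_sq k x / \<rho>\<^sup>2))) \<partial>base_measure k \<rho>) = ennreal (1 / sqrt ((1 - 4 * t) ^ k))"
proof -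
  define l where "l = (1 - 4 * t) / (2 * \<rho>\<^sup>2)"
  have l: "0 < l" unfolding l_def using \<rho> t by simp
  let ?c = "sqrt ((2 * pi) ^ k * (2 * \<rho>\<^sup>2) ^ k)"
  have c: "0 < ?c" using \<rho> by simp
  have "(\<integral>\<^sup>+x. ennreal (exp (t * (sum_sq k x / \<rho>\<^sup>2))) \<partial>base_measure k \<rho>) =
    (\<integral>\<^sup>+x. ennreal (base_density k \<rho> x) * ennreal (exp (t * (sum_sq k x / \<rho>\<^sup>2))) \<partial>PiM {..<k} (\<lambda>_. lborel))"
    unfolding base_measure_eq[OF \<rho>] by (rule nn_integral_density) auto
  also have "\<dots> = (\<integral>\<^sup>+x. ennreal (1 / ?c) * ennreal (exp (- (l * sum_sq k x) / 2)) \<partial>PiM {..<k} (\<lambda>_. lborel))"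
  proof (rule nn_integral_cong)
    fix x :: "nat \<Rightarrow> real"
    have "- sum_sq k x / (4 * \<rho>\<^sup>2) + t * (sum_sq k x / \<rho>\<^sup>2) = - (l * sum_sq k x) / 2"
      unfolding l_def using \<rho> by (simp add: field_simps)
    then have "exp (- sum_sq k x / (4 * \<rho>\<^sup>2)) * exp (t * (sum_sq k x / \<rho>\<^sup>2)) = exp (- (l * sum_sq k x) / 2)"
      by (simp add: exp_add[symmetric])
    then show "ennreal (base_density k \<rho> x) * ennreal (exp (t * (sum_sq k x / \<rho>\<^sup>2))) =
      ennreal (1 / ?c) * ennreal (exp (- (l * sum_sq k x) / 2))"
      using c unfolding base_density_def by (simp add: ennreal_mult[symmetric])
  qed
  also have "\<dots> = ennreal (1 / ?c) * (\<integral>\<^sup>+x. ennreal (exp (- (l * sum_sq k x) / 2)) \<partial>PiM {..<k} (\<lambda>_. lborel))"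
    by (rule nn_integral_cmult) auto
  also have "\<dots> = ennreal (1 / ?c * sqrt ((2 * pi) ^ k / l ^ k))"
    unfolding nn_integral_isotropic_gaussian[OF l] using c l by (intro ennreal_mult[symmetric]) auto
  also have "1 / ?c * sqrt ((2 * pi) ^ k / l ^ k) = 1 / sqrt ((1 - 4 * t) ^ k)"
  proof -
    have "(2 * pi) ^ k / l ^ k = ((2 * pi) ^ k * (2 * \<rho>\<^sup>2) ^ k) / (1 - 4 * t) ^ k"
      unfolding l_def power_divide by simp
    then show ?thesis using c \<rho> by (simp add: real_sqrt_divide)
  qed
  finally show ?thesis .
qed

lemma prob_space_base_measure:
  assumes "0 < \<rho>"
  shows "prob_space (base_measure k \<rho>)"
proof
  have "emeasure (base_measure k \<rho>) (space (base_measure k \<rho>)) = (\<integral>\<^sup>+x. 1 \<partial>base_measure k \<rho>)"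
    by simp
  then show "emeasure (base_measure k \<rho>) (space (base_measure k \<rho>)) = 1"
    using nn_integral_base_measure_exp[OF assms, of 0 k] by simp
qed

context gaussian_setting
begin

lemma prob_space_base: "prob_space (base_measure k \<rho>u)"
  by (rule prob_space_base_measure) (rule \<rho>u)

lemma measurable_base: "f \<in> borel_measurable (base_measure k \<rho>u) \<longleftrightarrow> f \<in> borel_measurable (PiM {..<k} (\<lambda>_. lborel))"
  unfolding base_measure_eq[OF \<rho>u] by simp

text \<open>
  The quotient of the two Lebesgue densities is a version of the Radon--Nikodym derivative, which is
  unique almost everywhere; \<open>log_quadratic\<close> describes the quotient.
\<close>

lemma gauss_p_exp_quad:
  assumes \<theta>: "\<theta> \<in> Theta k r \<rho>l \<rho>u"
  obtains c where "\<And>i j. i \<le> k \<Longrightarrow> j \<le> k \<Longrightarrow> \<bar>c i j\<bar> \<le> exp (8 * b)"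
    "AE x in base_measure k \<rho>u. gauss_p k \<rho>u \<theta> x = exp (quad (Suc k) c (homogenize k \<rho>u x))"
    "\<And>x. quad (Suc k) c (homogenize k \<rho>u x) \<le> b"
    "(\<integral>\<^sup>+x. ennreal (exp (quad (Suc k) c (homogenize k \<rho>u x))) \<partial>base_measure k \<rho>u) = 1"
proof -
  obtain m S where \<theta>_eq: "\<theta> = (m, S)" by (cases \<theta>)
  have m: "m \<in> carrier_vec k" "sqrt (scalar_prod m m) \<le> r" and S: "S \<in> carrier_mat k k" "transpose_mat S = S"
    and ev: "eigenvalue S a \<Longrightarrow> \<rho>l \<le> a \<and> a \<le> \<rho>u" for a
    using \<theta> unfolding \<theta>_eq Theta_def sym_pos_def_def by auto
  obtain W where W: "mat_inverse (S * S) = Some W" "W \<in> carrier_mat k k" "transpose_mat W = W"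
    and detW: "Determinant.det (S * S) = 1 / Determinant.det W" "Determinant.det W \<noteq> 0"
    and lower: "\<And>x. x \<in> carrier_vec k \<Longrightarrow> scalar_prod x x / \<rho>u\<^sup>2 \<le> scalar_prod x (W *\<^sub>v x)"
    and upper: "\<And>x. x \<in> carrier_vec k \<Longrightarrow> scalar_prod x (W *\<^sub>v x) \<le> scalar_prod x x / \<rho>l\<^sup>2"
    by (rule mat_inverse_square_symmetric[OF S ev \<rho>l]) auto
  define w where "w i j = W $$ (i,j)" for i j
  define d where "d = Determinant.det (Matrix.mat k k (\<lambda>(i,j). w i j))"
  have d_eq: "d = Determinant.det W"
    unfolding d_def w_def using W(2) by (intro arg_cong[of _ _ Determinant.det] eq_matI) auto
  have sym: "w i j = w j i" if "i < k" "j < k" for i j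
    unfolding w_def using W(2,3) that by (metis carrier_matD index_transpose_mat(1))
  have lowq: "sum_sq k x / \<rho>u\<^sup>2 \<le> quad k w x" for x
    unfolding w_def quad_eq_quadratic_form[OF W(2)] sum_sq_eq_scalar_prod by (rule lower) simp
  have uppq: "quad k w x \<le> sum_sq k x / \<rho>l\<^sup>2" for x
    unfolding w_def quad_eq_quadratic_form[OF W(2)] sum_sq_eq_scalar_prod by (rule upper) simp
  have mr: "sum_sq k (vec_index m) \<le> r\<^sup>2"
  proof -
    have "scalar_prod m m = sum_sq k (vec_index m)"
      using m(1) by (simp add: scalar_prod_def power2_eq_square lessThan_atLeast0)
    then show ?thesis using m(2) r real_le_rsqrt sqrt_le_D by fastforce
  qed
  obtain c where c: "\<And>i j. i \<le> k \<Longrightarrow> j \<le> k \<Longrightarrow> \<bar>c i j\<bar> \<le> exp (8 * b)"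
    and c_eq: "\<And>x. sqrt ((2 * \<rho>u\<^sup>2) ^ k * d) * exp (sum_sq k x / (4 * \<rho>u\<^sup>2) - quad k w (\<lambda>i. x i - vec_index m i) / 2) =
      exp (quad (Suc k) c (homogenize k \<rho>u x))"
    and c_le: "\<And>x. quad (Suc k) c (homogenize k \<rho>u x) \<le> b"
    using log_quadratic[OF sym lowq uppq mr] unfolding d_def by blast
  define h where "h = gaussian_lebesgue_density k m (S * S)"
  define e where "e x = exp (quad (Suc k) c (homogenize k \<rho>u x))" for x
  have pd: "0 < quad k w x" if "\<exists>i<k. x i \<noteq> 0" for x
  proof -
    have "0 < sum_sq k x / \<rho>u\<^sup>2" using that \<rho>u by (intro divide_pos_pos) (auto intro!: sum_pos2)
    then show ?thesis using lowq[of x] by simp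
  qed
  note gi = det_pos_and_nn_integral_gaussian[of k w "vec_index m", OF sym pd, folded d_def]
  have d: "0 < d" using gi by simp
  have h_eq: "h x = sqrt (d / (2 * pi) ^ k) * exp (- quad k w (\<lambda>i. x i - vec_index m i) / 2)" for x
    unfolding h_def gaussian_lebesgue_density_eq_quad[OF W(1,2) m(1)] w_def[abs_def] detW d_eq
    by (simp add: real_sqrt_divide real_sqrt_mult)
  have h_base: "base_density k \<rho>u x * e x = h x" for x
  proof -
    have "sqrt ((2 * \<rho>u\<^sup>2) ^ k * d) / sqrt ((2 * pi) ^ k * (2 * \<rho>u\<^sup>2) ^ k) = sqrt (d / (2 * pi) ^ k)"
      using \<rho>u by (simp add: real_sqrt_divide[symmetric])
    moreover have rearrange: "a / c * (q * e) = q / c * (a * e)" for a c q e :: real by simp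
    moreover have "exp (- sum_sq k x / (4 * \<rho>u\<^sup>2)) * exp (sum_sq k x / (4 * \<rho>u\<^sup>2) - quad k w (\<lambda>i. x i - vec_index m i) / 2)
        = exp (- quad k w (\<lambda>i. x i - vec_index m i) / 2)"
      by (simp add: exp_add[symmetric])
    ultimately show ?thesis
      unfolding e_def c_eq[symmetric] base_density_def h_eq
      by (simp only: rearrange)
  qed
  have e_meas: "e \<in> borel_measurable (PiM {..<k} (\<lambda>_. lborel))"
    unfolding e_def[abs_def] by measurable
  have dens: "density (base_measure k \<rho>u) (\<lambda>x. ennreal (e x)) = gaussian k m (S * S)"
    unfolding base_measure_eq[OF \<rho>u] gaussian_def h_def[symmetric]
    using e_meas base_density_pos[OF \<rho>u] h_base
    by (subst density_density_eq) (auto simp: e_def ennreal_mult[symmetric] less_imp_le)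
  interpret prob_space "base_measure k \<rho>u" by (rule prob_space_base)
  have "AE x in base_measure k \<rho>u. ennreal (e x) = RN_deriv (base_measure k \<rho>u) (gaussian k m (S * S)) x"
    using e_meas by (intro RN_deriv_unique dens) (simp add: measurable_base)
  then have ae: "AE x in base_measure k \<rho>u. gauss_p k \<rho>u \<theta> x = e x"
    unfolding gauss_p_def \<theta>_eq prod.case
  proof eventually_elim
    fix x assume "ennreal (e x) = RN_deriv (base_measure k \<rho>u) (gaussian k m (S * S)) x"
    from this[symmetric] show "enn2real (RN_deriv (base_measure k \<rho>u) (gaussian k m (S * S)) x) = e x"
      by (simp only: enn2real_ennreal e_def exp_ge_zero)
  qed
  have "(\<integral>\<^sup>+x. ennreal (e x) \<partial>base_measure k \<rho>u) = (\<integral>\<^sup>+x. ennreal (h x) \<partial>PiM {..<k} (\<lambda>_. lborel))"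
    unfolding base_measure_eq[OF \<rho>u] using e_meas
    by (subst nn_integral_density)
      (auto simp: h_base[symmetric] ennreal_mult[symmetric] e_def base_density_pos[OF \<rho>u] less_imp_le)
  also have "\<dots> = ennreal (sqrt (d / (2 * pi) ^ k)) * ennreal (sqrt ((2 * pi) ^ k / d))"
    unfolding h_eq using gi d by (simp add: ennreal_mult nn_integral_cmult quad_def)
  also have "\<dots> = 1" using d by (simp add: ennreal_mult[symmetric] real_sqrt_mult[symmetric])
  finally have "(\<integral>\<^sup>+x. ennreal (e x) \<partial>base_measure k \<rho>u) = 1" .
  with c ae c_le show ?thesis unfolding e_def using that by blast
qed

end

section \<open>Model selection over a sequence of finite families\<close>

lemma pmf_bind_ge: "pmf N x * pmf (f x) y \<le> pmf (bind_pmf N f) y"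
proof -
  have "ennreal (pmf (f x) y * pmf N x) = (\<integral>\<^sup>+z. ennreal (pmf (f x) y) * indicator {x} z \<partial>measure_pmf N)"
    by (simp add: nn_integral_cmult_indicator emeasure_pmf_single ennreal_mult)
  also have "\<dots> \<le> (\<integral>\<^sup>+z. ennreal (pmf (f z) y) \<partial>measure_pmf N)"
    by (intro nn_integral_mono) (auto split: split_indicator)
  also have "\<dots> = ennreal (pmf (bind_pmf N f) y)" by (simp add: ennreal_pmf_bind)
  finally show ?thesis by (simp add: mult.commute)
qed

text \<open>
  The subprobability picks a level from the geometric distribution with parameter $1/2$ and then a
  space of that level uniformly. A space may occur at several levels; a lower bound of its mass is
  enough.
\<close>

lemma model_selection_over_finite_families:
  fixes F :: "nat \<Rightarrow> ('a \<Rightarrow> real) set set" and w :: "nat \<Rightarrow> real"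
  assumes ms: "model_selection C0 n M"
    and fin: "\<And>i. finite (F i)" and ne: "\<And>i. F i \<noteq> {}"
    and sub: "\<And>i S. S \<in> F i \<Longrightarrow> fin_dim_subspace M S"
    and card: "\<And>i. real (card (F i)) \<le> exp (w i)"
  obtains shat where "estimator n M shat"
    "\<And>s i S. bounded_density M s \<Longrightarrow> S \<in> F i \<Longrightarrow>
       L2_risk n M s shat \<le> ennreal C0 * (ennreal ((L2_setdist M s S)\<^sup>2) +
         ennreal (tau n M s) * ennreal (real (max (L2_dim M S) 1) + (real i + 1) + w i))"
proof -
  define SS where "SS = (\<Union>i. F i)"
  define q where "q = bind_pmf (geometric_pmf (1 / 2)) (\<lambda>i. pmf_of_set (F i))"
  define \<pi> where "\<pi> = restrict_space (measure_pmf q) SS"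
  have "SS \<noteq> {}" unfolding SS_def using ne by auto
  then have subprob: "subprob_space \<pi>"
    unfolding \<pi>_def by (intro subprob_spaceI) (auto simp: space_restrict_space emeasure_restrict_space
        measure_pmf.subprob_emeasure_le_1)
  have sets: "sets \<pi> = Pow SS" unfolding \<pi>_def by (auto simp: sets_restrict_space)
  have "countable SS" unfolding SS_def using fin by (auto intro: countable_finite)
  then obtain shat where shat: "estimator n M shat"
    and risk: "\<And>s. bounded_density M s \<Longrightarrow> L2_risk n M s shat \<le> ennreal C0 *
      (INF S\<in>SS. ennreal ((L2_setdist M s S)\<^sup>2) +
         ennreal (tau n M s) * (ennreal (real (max (L2_dim M S) 1)) + Delta \<pi> S))"
  proof -
    have "\<forall>S\<in>SS. fin_dim_subspace M S" using sub by (auto simp: SS_def)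
    with \<open>countable SS\<close> subprob sets have "countable SS \<and> (\<forall>S\<in>SS. fin_dim_subspace M S) \<and>
      subprob_space \<pi> \<and> sets \<pi> = Pow SS" by simp
    from mp[OF spec[OF spec[OF ms[unfolded model_selection_def]]] this]
    show thesis by (elim exE conjE) (rule that, blast+)
  qed
  have Delta: "Delta \<pi> S \<le> ennreal (real i + 1 + w i)" if S: "S \<in> F i" for S i
  proof -
    have pos: "0 < real (card (F i))" using fin ne by (simp add: card_gt_0_iff)
    define p where "p = measure \<pi> {S}"
    have "p = pmf q S"
      unfolding p_def \<pi>_def using S by (subst measure_restrict_space) (auto simp: SS_def measure_pmf_single)
    moreover have "(1 / 2) ^ Suc i * (1 / real (card (F i))) \<le> pmf q S"
      using pmf_bind_ge[of "geometric_pmf (1 / 2)" i "\<lambda>i. pmf_of_set (F i)" S] S fin ne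
      unfolding q_def by simp
    ultimately have p: "(1 / 2) ^ Suc i * (1 / real (card (F i))) \<le> p" by simp
    have lpos: "0 < (1 / 2) ^ Suc i * (1 / real (card (F i)))" using pos by simp
    with p have "0 < p" by linarith
    have "ln ((1 / 2) ^ Suc i * (1 / real (card (F i)))) \<le> ln p"
      using p lpos \<open>0 < p\<close> by (subst ln_le_cancel_iff) auto
    moreover have "ln ((1 / 2) ^ Suc i * (1 / real (card (F i)))) = - ((real i + 1) * ln 2) - ln (real (card (F i)))"
      using pos by (simp add: ln_mult ln_realpow ln_div algebra_simps)
    moreover have "ln (real (card (F i))) \<le> w i"
      using card[of i] pos by (metis ln_exp ln_le_cancel_iff exp_gt_zero)
    moreover have "(real i + 1) * ln 2 \<le> real i + 1"
      using ln_2_less_1 by (simp add: mult_le_cancel_left1)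
    ultimately have "- ln p \<le> real i + 1 + w i" by linarith
    then show ?thesis
      unfolding Delta_def p_def[symmetric] using \<open>0 < p\<close> by (auto intro: ennreal_leI)
  qed
  show ?thesis
  proof (rule that[OF shat])
    fix s i S assume s: "bounded_density M s" and S: "S \<in> F i"
    have pos: "1 \<le> real (card (F i))" using fin[of i] ne[of i]
      by (metis One_nat_def Suc_leI card_gt_0_iff of_nat_1 of_nat_mono)
    then have "1 \<le> exp (w i)" using card[of i] by (rule order_trans)
    then have w: "0 \<le> w i" by simp
    have "L2_risk n M s shat \<le> ennreal C0 * (ennreal ((L2_setdist M s S)\<^sup>2) +
         ennreal (tau n M s) * (ennreal (real (max (L2_dim M S) 1)) + Delta \<pi> S))"
      using S by (intro order_trans[OF risk[OF s]] mult_left_mono INF_lower) (auto simp: SS_def)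
    also have "\<dots> \<le> ennreal C0 * (ennreal ((L2_setdist M s S)\<^sup>2) +
         ennreal (tau n M s) * (ennreal (real (max (L2_dim M S) 1)) + ennreal (real i + 1 + w i)))"
      using Delta[OF S] by (intro mult_left_mono add_left_mono) auto
    also have "ennreal (real (max (L2_dim M S) 1)) + ennreal (real i + 1 + w i) =
        ennreal (real (max (L2_dim M S) 1) + (real i + 1) + w i)"
      using w by (simp add: ennreal_plus[symmetric] add.assoc del: ennreal_plus)
    finally show "L2_risk n M s shat \<le> ennreal C0 * (ennreal ((L2_setdist M s S)\<^sup>2) +
         ennreal (tau n M s) * ennreal (real (max (L2_dim M S) 1) + (real i + 1) + w i))" .
  qed
qed

section \<open>Nets of Gaussian mixtures\<close>

lemma L2_dist_nonneg: "0 \<le> L2_dist M f g"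
  unfolding L2_dist_def by simp

lemma L2_dist_sq: "(L2_dist M f g)\<^sup>2 = (LINT x|M. (f x - g x)\<^sup>2)"
  unfolding L2_dist_def by simp

lemma integrable_diff_sq:
  assumes "f \<in> L2_fun M" "g \<in> L2_fun M"
  shows "integrable M (\<lambda>x. (f x - g x)\<^sup>2)"
proof (rule Bochner_Integration.integrable_bound)
  show "integrable M (\<lambda>x. 2 * (f x)\<^sup>2 + 2 * (g x)\<^sup>2)"
    using assms by (auto simp: L2_fun_def)
  show "(\<lambda>x. (f x - g x)\<^sup>2) \<in> borel_measurable M"
    using assms by (auto simp: L2_fun_def)
  have "(u - v)\<^sup>2 \<le> 2 * u\<^sup>2 + 2 * v\<^sup>2" for u v :: real
    using zero_le_power2[of "u + v"] by (simp add: power2_eq_square algebra_simps)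
  then show "AE x in M. norm ((f x - g x)\<^sup>2) \<le> norm (2 * (f x)\<^sup>2 + 2 * (g x)\<^sup>2)"
    by simp
qed

lemma L2_dist_sq_triangle:
  assumes f: "f \<in> L2_fun M" and g: "g \<in> L2_fun M" and h: "h \<in> L2_fun M"
  shows "(L2_dist M f h)\<^sup>2 \<le> 2 * (L2_dist M f g)\<^sup>2 + 2 * (L2_dist M g h)\<^sup>2"
proof -
  note i = integrable_diff_sq[OF f g] integrable_diff_sq[OF g h] integrable_diff_sq[OF f h]
  have "(u - w)\<^sup>2 \<le> 2 * (u - v)\<^sup>2 + 2 * (v - w)\<^sup>2" for u v w :: real
    using zero_le_power2[of "u - 2 * v + w"] by (simp add: power2_eq_square algebra_simps)
  then have "(LINT x|M. (f x - h x)\<^sup>2) \<le> (LINT x|M. 2 * (f x - g x)\<^sup>2 + 2 * (g x - h x)\<^sup>2)"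
    using i by (intro integral_mono) auto
  also have "\<dots> = 2 * (LINT x|M. (f x - g x)\<^sup>2) + 2 * (LINT x|M. (g x - h x)\<^sup>2)"
    using i by simp
  finally show ?thesis unfolding L2_dist_sq .
qed

lemma L2_setdist_sq_le:
  assumes "t \<in> S"
  shows "(L2_setdist M s S)\<^sup>2 \<le> (L2_dist M s t)\<^sup>2"
proof -
  have "L2_setdist M s S \<le> L2_dist M s t"
    unfolding L2_setdist_def using assms
    by (intro cINF_lower) (auto intro!: bdd_belowI[of _ 0] L2_dist_nonneg)
  moreover have "0 \<le> L2_setdist M s S"
    unfolding L2_setdist_def using assms by (intro cINF_greatest L2_dist_nonneg) auto
  ultimately show ?thesis by (intro power_mono)
qed

lemma bounded_imp_L2_fun:
  assumes "finite_measure M" "f \<in> borel_measurable M" "\<And>x. \<bar>f x\<bar> \<le> B"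
  shows "f \<in> L2_fun M"
proof -
  interpret finite_measure M by fact
  have "integrable M (\<lambda>x. (f x)\<^sup>2)"
  proof (rule integrable_const_bound[where B="B\<^sup>2"])
    have "(f x)\<^sup>2 \<le> B\<^sup>2" for x
      using power_mono[OF assms(3)[of x], of 2] by simp
    then show "AE x in M. norm ((f x)\<^sup>2) \<le> B\<^sup>2" by simp
  qed (use assms(2) in auto)
  then show ?thesis using assms(2) by (simp add: L2_fun_def)
qed

text \<open>
  The functions $f_j$ need not be distinct, whereas a span is indexed by the set of its generators;
  coefficients of equal functions are added up.
\<close>

lemma sum_mem_L2_span_image:
  assumes "finite J" and mem: "(\<lambda>x. \<Sum>j\<in>J. a j * f j x) \<in> L2_fun M"
  shows "(\<lambda>x. \<Sum>j\<in>J. a j * f j x) \<in> L2_span M (f ` J)"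
proof -
  have "(\<Sum>j\<in>J. a j * f j x) = (\<Sum>h\<in>f ` J. (\<Sum>j\<in>{j\<in>J. f j = h}. a j) * h x)" for x
  proof -
    have "(\<Sum>j\<in>J. a j * f j x) = (\<Sum>h\<in>f ` J. \<Sum>j\<in>{j\<in>J. f j = h}. a j * f j x)"
      using assms(1) by (rule sum.image_gen)
    also have "\<dots> = (\<Sum>h\<in>f ` J. (\<Sum>j\<in>{j\<in>J. f j = h}. a j) * h x)"
      unfolding sum_distrib_right by (intro sum.cong) auto
    finally show ?thesis .
  qed
  with mem show ?thesis unfolding L2_span_def by (intro CollectI conjI exI AE_I2) auto
qed

lemma exp_min_Lipschitz: "\<bar>exp (min b u) - exp (min b v)\<bar> \<le> exp b * \<bar>u - v\<bar>" for b u v :: real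
proof -
  have *: "exp p - exp q \<le> exp b * (p - q)" if "q \<le> p" "p \<le> b" for p q :: real
  proof -
    have "exp p - exp q = exp p * (1 - exp (q - p))" by (simp add: exp_diff algebra_simps)
    also have "\<dots> \<le> exp p * (p - q)"
    proof (rule mult_left_mono)
      show "1 - exp (q - p) \<le> p - q" using exp_ge_add_one_self[of "q - p"] by linarith
    qed simp
    also have "\<dots> \<le> exp b * (p - q)" using that by (intro mult_right_mono) auto
    finally show ?thesis .
  qed
  have **: "\<bar>exp p - exp q\<bar> \<le> exp b * \<bar>p - q\<bar>" if "p \<le> b" "q \<le> b" for p q :: real
    using *[of p q] *[of q p] that by (cases "q \<le> p") auto
  have "\<bar>exp (min b u) - exp (min b v)\<bar> \<le> exp b * \<bar>min b u - min b v\<bar>"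
    by (rule **) auto
  also have "\<dots> \<le> exp b * \<bar>u - v\<bar>" by (intro mult_left_mono) (auto simp: min_def)
  finally show ?thesis .
qed

lemma quad_diff_le:
  assumes "\<And>i j. i < n \<Longrightarrow> j < n \<Longrightarrow> \<bar>c i j - c' i j\<bar> \<le> \<delta>"
  shows "\<bar>quad n c y - quad n c' y\<bar> \<le> \<delta> * (real n * sum_sq n y)"
proof (cases "n = 0")
  case False
  then have \<delta>: "0 \<le> \<delta>" using assms[of 0 0] by simp
  have "quad n c y - quad n c' y = (\<Sum>i<n. \<Sum>j<n. (c i j - c' i j) * y i * y j)"
    unfolding quad_def by (simp add: sum_subtractf left_diff_distrib)
  also have "\<bar>\<dots>\<bar> \<le> (\<Sum>i<n. \<Sum>j<n. \<bar>(c i j - c' i j) * y i * y j\<bar>)"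
    by (intro order_trans[OF sum_abs] sum_mono) auto
  also have "\<dots> \<le> (\<Sum>i<n. \<Sum>j<n. \<delta> * ((y i)\<^sup>2 / 2 + (y j)\<^sup>2 / 2))"
  proof (intro sum_mono)
    fix i j assume ij: "i \<in> {..<n}" "j \<in> {..<n}"
    have "\<bar>(c i j - c' i j) * y i * y j\<bar> = \<bar>c i j - c' i j\<bar> * (\<bar>y i\<bar> * \<bar>y j\<bar>)"
      by (simp add: abs_mult)
    also have "\<dots> \<le> \<delta> * ((y i)\<^sup>2 / 2 + (y j)\<^sup>2 / 2)"
      using ij assms \<delta> sum_squares_bound[of "\<bar>y i\<bar>" "\<bar>y j\<bar>"] by (intro mult_mono) auto
    finally show "\<bar>(c i j - c' i j) * y i * y j\<bar> \<le> \<delta> * ((y i)\<^sup>2 / 2 + (y j)\<^sup>2 / 2)" .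
  qed
  also have "\<dots> = \<delta> * (real n * sum_sq n y)"
    by (simp add: sum_distrib_left[symmetric] sum.distrib sum_divide_distrib[symmetric])
  finally show ?thesis .
qed (simp add: quad_def)

text \<open>
  The mesh $2^{-i}$ and the range $2^i$ are governed by the same parameter, so that the family of all
  grids refers to no bound on the coefficients.
\<close>

definition grid :: "nat \<Rightarrow> real set" where
  "grid i = (\<lambda>z. of_int z / 2 ^ i) ` {- (4 ^ i)..4 ^ i}"

lemma finite_grid: "finite (grid i)" and grid_nonempty: "grid i \<noteq> {}"
  unfolding grid_def by auto

lemma card_grid_le: "real (card (grid i)) \<le> exp (2 * (real i + 1))"
proof -
  have "card (grid i) \<le> card {- (4 ^ i)..4 ^ i :: int}"
    unfolding grid_def by (rule card_image_le) simp
  also have "\<dots> = 2 * 4 ^ i + 1" by (simp add: nat_add_distrib nat_mult_distrib nat_power_eq)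
  finally have "real (card (grid i)) \<le> 2 * 4 ^ i + 1"
    by (metis (mono_tags, opaque_lifting) of_nat_1 of_nat_add of_nat_le_iff of_nat_mult of_nat_numeral of_nat_power)
  also have "\<dots> \<le> 4 * 4 ^ i"
  proof -
    have "(1::real) \<le> 4 ^ i" by simp
    then show ?thesis by linarith
  qed
  also have "\<dots> = 4 ^ Suc i" by simp
  also have "\<dots> \<le> exp 2 ^ Suc i"
  proof (rule power_mono)
    have "(2::real) \<le> exp 1" using exp_ge_add_one_self[of 1] by simp
    then have "(2::real)\<^sup>2 \<le> (exp 1)\<^sup>2" by (rule power_mono) simp
    then show "(4::real) \<le> exp 2" by (simp add: exp_double[symmetric])
  qed simp
  also have "\<dots> = exp (2 * (real i + 1))"
    unfolding exp_of_nat_mult[symmetric] by (simp add: algebra_simps)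
  finally show ?thesis .
qed

lemma grid_approx:
  assumes "\<bar>a\<bar> \<le> 2 ^ i"
  shows "\<exists>g\<in>grid i. \<bar>a - g\<bar> \<le> 1 / 2 ^ i"
proof -
  define z where "z = \<lfloor>a * 2 ^ i\<rfloor>"
  have four: "(2::real) ^ i * 2 ^ i = 4 ^ i" by (simp add: power_mult_distrib[symmetric])
  have "a * 2 ^ i \<le> 2 ^ i * 2 ^ i" "- (2 ^ i) * 2 ^ i \<le> a * 2 ^ i"
    using assms by (intro mult_right_mono; simp add: abs_le_iff)+
  then have "a * 2 ^ i \<le> 4 ^ i" "- (4 ^ i) \<le> a * 2 ^ i" using four by auto
  then have "z \<in> {- (4 ^ i)..4 ^ i}"
    unfolding z_def by (auto simp: le_floor_iff floor_le_iff)
  moreover have "\<bar>a - of_int z / 2 ^ i\<bar> = \<bar>a * 2 ^ i - of_int z\<bar> / 2 ^ i"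
  proof -
    have "a - of_int z / 2 ^ i = (a * 2 ^ i - of_int z) / 2 ^ i" by (simp add: field_simps)
    then show ?thesis by (simp add: abs_divide)
  qed
  moreover have "\<bar>a * 2 ^ i - of_int z\<bar> \<le> 1" unfolding z_def by linarith
  ultimately show ?thesis
    unfolding grid_def by (intro bexI[of _ "of_int z / 2 ^ i"]) (auto simp: divide_right_mono)
qed

context gaussian_setting
begin

abbreviation "\<mu> \<equiv> base_measure k \<rho>u"

text \<open>
  The cap at $b$ leaves the densities themselves unchanged and makes their perturbations bounded, hence
  square integrable.
\<close>

definition capped :: "(nat \<times> nat \<Rightarrow> real) \<Rightarrow> (nat \<Rightarrow> real) \<Rightarrow> real" where
  "capped c x = exp (min b (quad (Suc k) (curry c) (homogenize k \<rho>u x)))"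

definition net :: "nat \<Rightarrow> nat \<Rightarrow> (nat \<Rightarrow> nat \<times> nat \<Rightarrow> real) set" where
  "net l i = ({..<l} \<rightarrow>\<^sub>E ({..k} \<times> {..k} \<rightarrow>\<^sub>E grid i))"

definition net_spaces :: "nat \<Rightarrow> nat \<Rightarrow> ((nat \<Rightarrow> real) \<Rightarrow> real) set set" where
  "net_spaces l i = (\<lambda>z. L2_span \<mu> ((\<lambda>j. capped (z j)) ` {..<l})) ` net l i"

lemma finite_net: "finite (net l i)" and net_nonempty: "net l i \<noteq> {}"
  unfolding net_def using finite_grid grid_nonempty by (auto intro!: finite_PiE simp: PiE_eq_empty_iff)

lemma card_net_spaces_le:
  "real (card (net_spaces l i)) \<le> exp (2 * (real i + 1) * (real k + 1)\<^sup>2 * real l)"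
proof -
  have "card (net_spaces l i) \<le> card (net l i)"
    unfolding net_spaces_def using finite_net by (rule card_image_le)
  also have "\<dots> = (card (grid i) ^ (Suc k * Suc k)) ^ l"
    unfolding net_def by (simp add: card_PiE)
  finally have "real (card (net_spaces l i)) \<le> real (card (grid i)) ^ (Suc k * Suc k * l)"
    by (metis of_nat_le_iff of_nat_power power_mult)
  also have "\<dots> \<le> exp (2 * (real i + 1)) ^ (Suc k * Suc k * l)"
    by (intro power_mono card_grid_le) simp
  also have "\<dots> = exp (2 * (real i + 1) * (real k + 1)\<^sup>2 * real l)"
    unfolding exp_of_nat_mult[symmetric] by (simp add: power2_eq_square algebra_simps)
  finally show ?thesis .
qed

lemma finite_measure_base: "finite_measure \<mu>"
  using prob_space_base by (simp add: prob_space_def)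

lemma exp_quad_measurable:
  "(\<lambda>x. exp (quad (Suc k) c (homogenize k \<rho>u x))) \<in> borel_measurable \<mu>"
  unfolding measurable_base by measurable

lemma capped_measurable: "capped c \<in> borel_measurable \<mu>"
  unfolding measurable_base capped_def[abs_def] by measurable

lemma capped_L2_fun: "capped c \<in> L2_fun \<mu>"
  by (rule bounded_imp_L2_fun[OF finite_measure_base capped_measurable, of _ "exp b"])
    (simp add: capped_def)

lemma net_space_fin_dim:
  assumes "S \<in> net_spaces l i"
  shows "fin_dim_subspace \<mu> S" "L2_dim \<mu> S \<le> l"
proof -
  obtain z where S: "S = L2_span \<mu> ((\<lambda>j. capped (z j)) ` {..<l})"
    using assms by (auto simp: net_spaces_def)
  let ?B = "(\<lambda>j. capped (z j)) ` {..<l}"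
  have B: "finite ?B" "?B \<subseteq> L2_fun \<mu>" by (auto simp: capped_L2_fun)
  then show "fin_dim_subspace \<mu> S" unfolding fin_dim_subspace_def S by blast
  have "L2_dim \<mu> S \<le> card ?B"
    unfolding L2_dim_def by (rule Least_le) (use B S in blast)
  also have "\<dots> \<le> l" using card_image_le[of "{..<l}" "\<lambda>j. capped (z j)"] by simp
  finally show "L2_dim \<mu> S \<le> l" .
qed

lemma mixture_L2_fun:
  assumes e: "\<And>j. j < l \<Longrightarrow> e j \<in> borel_measurable \<mu>" "\<And>j x. j < l \<Longrightarrow> 0 \<le> e j x \<and> e j x \<le> exp b"
    and q: "\<And>j. j < l \<Longrightarrow> 0 \<le> q j" "(\<Sum>j<l. q j) = 1"
  shows "(\<lambda>x. \<Sum>j<l. q j * e j x) \<in> L2_fun \<mu>" "0 \<le> (\<Sum>j<l. q j * e j x)" "(\<Sum>j<l. q j * e j x) \<le> exp b"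
proof -
  have b: "0 \<le> (\<Sum>j<l. q j * e j x) \<and> (\<Sum>j<l. q j * e j x) \<le> exp b" for x
  proof
    show "0 \<le> (\<Sum>j<l. q j * e j x)" using e q by (intro sum_nonneg) auto
    have "(\<Sum>j<l. q j * e j x) \<le> (\<Sum>j<l. q j * exp b)"
      using e q by (intro sum_mono mult_left_mono) auto
    then show "(\<Sum>j<l. q j * e j x) \<le> exp b" using q(2) by (simp add: sum_distrib_right[symmetric])
  qed
  then show "0 \<le> (\<Sum>j<l. q j * e j x)" "(\<Sum>j<l. q j * e j x) \<le> exp b" by auto
  show "(\<lambda>x. \<Sum>j<l. q j * e j x) \<in> L2_fun \<mu>"
    by (rule bounded_imp_L2_fun[OF finite_measure_base, of _ "exp b"]) (use e b in auto)
qed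

lemma gauss_p_measurable: "gauss_p k \<rho>u \<theta> \<in> borel_measurable \<mu>"
  unfolding gauss_p_def by (cases \<theta>) simp

lemma two_pow_le_exp: "sqrt (2 ^ k) \<le> exp (3 * b)"
proof -
  have "sqrt (2 ^ k) \<le> sqrt ((2 ^ k)\<^sup>2)" by (intro real_sqrt_le_mono self_le_power) auto
  also have "\<dots> = 2 ^ k" by simp
  also have "\<dots> \<le> exp 1 ^ k" using exp_ge_add_one_self[of 1] by (intro power_mono) auto
  also have "\<dots> = exp (real k)" by (simp add: exp_of_nat_mult[symmetric])
  also have "\<dots> \<le> exp (3 * b)" using k_le by simp
  finally show ?thesis .
qed

text \<open>
  The envelope bounds the change of the exponent. Its square is a polynomial of degree four in
  $|x|/\overline\rho$ and is dominated by an exponential with finite integral.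
\<close>

lemma envelope_sq_le:
  "(real (Suc k) * sum_sq (Suc k) (homogenize k \<rho>u x))\<^sup>2 \<le> 256 * exp (6 * b) * exp (1 / 8 * (sum_sq k x / \<rho>u\<^sup>2))"
proof -
  define t where "t = sum_sq k x / \<rho>u\<^sup>2"
  have t: "0 \<le> t" unfolding t_def by (simp add: sum_nonneg)
  have "sum_sq (Suc k) (homogenize k \<rho>u x) = t + 1"
    unfolding t_def by (simp add: homogenize_def power_divide sum_divide_distrib)
  moreover have "real (Suc k) \<le> exp (3 * b)"
    using k_le exp_ge_add_one_self[of "3 * b"] unfolding of_nat_Suc by linarith
  moreover have "t + 1 \<le> 16 * exp (t / 16)"
    using exp_ge_add_one_self[of "t / 16"] by linarith
  ultimately have "real (Suc k) * sum_sq (Suc k) (homogenize k \<rho>u x) \<le> exp (3 * b) * (16 * exp (t / 16))"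
    using t by (intro mult_mono) auto
  then have "(real (Suc k) * sum_sq (Suc k) (homogenize k \<rho>u x))\<^sup>2 \<le> (exp (3 * b) * (16 * exp (t / 16)))\<^sup>2"
    by (intro power_mono mult_nonneg_nonneg sum_nonneg) simp_all
  also have "\<dots> = 256 * exp (6 * b) * exp (1 / 8 * t)"
    by (simp add: power_mult_distrib exp_double[symmetric])
  finally show ?thesis unfolding t_def .
qed

text \<open>
  First claim: every space contains $0$, and $\|f\|^2\le e^b\int f\,d\mu=e^b$ for a mixture $f$ of
  densities bounded by $e^b$. Second claim: once the range $2^i$ of the grid exceeds the coefficients,
  rounding changes each exponent by at most $2^{-i}$ times a quadratic envelope, uniformly in $\theta$,
  so that convexity passes the bound from the components to the mixture.
\<close>

lemma mixture_near_net:
  fixes \<theta> :: "nat \<Rightarrow> real vec \<times> real mat"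
  assumes \<theta>: "\<And>j. j < l \<Longrightarrow> \<theta> j \<in> Theta k r \<rho>l \<rho>u"
    and q: "\<And>j. j < l \<Longrightarrow> 0 \<le> q j" "(\<Sum>j<l. q j) = 1" and s: "s \<in> L2_fun \<mu>"
  shows "S \<in> net_spaces l i \<Longrightarrow>
      (L2_setdist \<mu> s S)\<^sup>2 \<le> 2 * (L2_dist \<mu> s (\<lambda>x. \<Sum>j<l. q j * gauss_p k \<rho>u (\<theta> j) x))\<^sup>2 + 2 * exp b"
    and "exp (8 * b) \<le> 2 ^ i \<Longrightarrow> \<exists>S\<in>net_spaces l i.
      (L2_setdist \<mu> s S)\<^sup>2 \<le> 2 * (L2_dist \<mu> s (\<lambda>x. \<Sum>j<l. q j * gauss_p k \<rho>u (\<theta> j) x))\<^sup>2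
        + 512 * exp (11 * b) / 4 ^ i"
proof -
  interpret prob_space \<mu> by (rule prob_space_base)
  define P where "P j c \<longleftrightarrow> (\<forall>i\<le>k. \<forall>i'\<le>k. \<bar>c i i'\<bar> \<le> exp (8 * b)) \<and>
    (AE x in \<mu>. gauss_p k \<rho>u (\<theta> j) x = exp (quad (Suc k) c (homogenize k \<rho>u x))) \<and>
    (\<forall>x. quad (Suc k) c (homogenize k \<rho>u x) \<le> b) \<and>
    (\<integral>\<^sup>+x. ennreal (exp (quad (Suc k) c (homogenize k \<rho>u x))) \<partial>\<mu>) = 1" for j c
  have "\<exists>c. P j c" if "j < l" for j
    unfolding P_def by (rule gauss_p_exp_quad[OF \<theta>[OF that]]) blast
  then have "\<forall>j\<in>{..<l}. \<exists>c. P j c" by simp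
  then obtain c where "\<forall>j\<in>{..<l}. P j (c j)" by (rule bchoice[THEN exE])
  then have "P j (c j)" if "j < l" for j using that by simp
  then have c: "\<And>j i i'. j < l \<Longrightarrow> i \<le> k \<Longrightarrow> i' \<le> k \<Longrightarrow> \<bar>c j i i'\<bar> \<le> exp (8 * b)"
    and c_ae: "\<And>j. j < l \<Longrightarrow> AE x in \<mu>. gauss_p k \<rho>u (\<theta> j) x = exp (quad (Suc k) (c j) (homogenize k \<rho>u x))"
    and c_le: "\<And>j x. j < l \<Longrightarrow> quad (Suc k) (c j) (homogenize k \<rho>u x) \<le> b"
    and c_int: "\<And>j. j < l \<Longrightarrow> (\<integral>\<^sup>+x. ennreal (exp (quad (Suc k) (c j) (homogenize k \<rho>u x))) \<partial>\<mu>) = 1"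
    unfolding P_def by simp_all
  define e where "e j x = exp (quad (Suc k) (c j) (homogenize k \<rho>u x))" for j x
  define m where "m x = (\<Sum>j<l. q j * e j x)" for x
  have e_meas: "e j \<in> borel_measurable \<mu>" for j
    unfolding e_def[abs_def] by (rule exp_quad_measurable)
  have e_bd: "0 \<le> e j x \<and> e j x \<le> exp b" if "j < l" for j x
    unfolding e_def using c_le[OF that] by simp
  have m: "m \<in> L2_fun \<mu>" "\<And>x. 0 \<le> m x" "\<And>x. m x \<le> exp b"
    unfolding m_def[abs_def] using mixture_L2_fun[OF e_meas e_bd q] by auto
  have "L2_dist \<mu> s (\<lambda>x. \<Sum>j<l. q j * gauss_p k \<rho>u (\<theta> j) x) = L2_dist \<mu> s m"
    unfolding L2_dist_def
  proof (intro arg_cong[of _ _ sqrt] integral_cong_AE)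
    show "(\<lambda>x. (s x - (\<Sum>j<l. q j * gauss_p k \<rho>u (\<theta> j) x))\<^sup>2) \<in> borel_measurable \<mu>"
      using s gauss_p_measurable unfolding L2_fun_def
      by (intro borel_measurable_power borel_measurable_diff borel_measurable_sum borel_measurable_times) auto
    show "(\<lambda>x. (s x - m x)\<^sup>2) \<in> borel_measurable \<mu>" using s m(1) by (auto simp: L2_fun_def)
    have "AE x in \<mu>. \<forall>j\<in>{..<l}. gauss_p k \<rho>u (\<theta> j) x = e j x"
      unfolding e_def using c_ae by (intro AE_finite_allI) auto
    then show "AE x in \<mu>. (s x - (\<Sum>j<l. q j * gauss_p k \<rho>u (\<theta> j) x))\<^sup>2 = (s x - m x)\<^sup>2"
      by eventually_elim (simp add: m_def)
  qed
  note dist_eq = this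
  {
    assume S: "S \<in> net_spaces l i"
    then have "(\<lambda>x. 0) \<in> S"
      unfolding net_spaces_def L2_span_def L2_fun_def by (auto intro!: exI[of _ "\<lambda>_. 0"])
    then have "(L2_setdist \<mu> s S)\<^sup>2 \<le> (L2_dist \<mu> s (\<lambda>x. 0))\<^sup>2" by (rule L2_setdist_sq_le)
    also have "\<dots> \<le> 2 * (L2_dist \<mu> s m)\<^sup>2 + 2 * (L2_dist \<mu> m (\<lambda>x. 0))\<^sup>2"
      by (intro L2_dist_sq_triangle s m) (simp add: L2_fun_def)
    also have "(L2_dist \<mu> m (\<lambda>x. 0))\<^sup>2 \<le> exp b"
    proof -
      have e_int: "integrable \<mu> (e j)" "(LINT x|\<mu>. e j x) = 1" if "j < l" for j
      proof -
        show "integrable \<mu> (e j)"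
          using e_bd[OF that] e_meas by (intro integrable_const_bound[where B="exp b"]) auto
        show "(LINT x|\<mu>. e j x) = 1"
          using c_int[OF that] e_meas[of j] unfolding e_def by (subst integral_eq_nn_integral) auto
      qed
      have "(L2_dist \<mu> m (\<lambda>x. 0))\<^sup>2 = (LINT x|\<mu>. (m x)\<^sup>2)" by (simp add: L2_dist_sq)
      also have "\<dots> \<le> (LINT x|\<mu>. exp b * m x)"
      proof (rule integral_mono)
        show "integrable \<mu> (\<lambda>x. (m x)\<^sup>2)" using m(1) by (simp add: L2_fun_def)
        show "integrable \<mu> (\<lambda>x. exp b * m x)"
          unfolding m_def using e_int by (intro integrable_mult_right Bochner_Integration.integrable_sum) auto
        show "(m x)\<^sup>2 \<le> exp b * m x" for x
          unfolding power2_eq_square using m by (intro mult_right_mono) auto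
      qed
      also have "\<dots> = exp b * (\<Sum>j<l. q j * (LINT x|\<mu>. e j x))"
        unfolding m_def using e_int by (simp add: Bochner_Integration.integral_sum)
      also have "\<dots> = exp b" using e_int q by simp
      finally show ?thesis .
    qed
    finally show "(L2_setdist \<mu> s S)\<^sup>2 \<le> 2 * (L2_dist \<mu> s (\<lambda>x. \<Sum>j<l. q j * gauss_p k \<rho>u (\<theta> j) x))\<^sup>2 + 2 * exp b"
      unfolding dist_eq by simp
  }
  assume i: "exp (8 * b) \<le> 2 ^ i"
  define \<delta> :: real where "\<delta> = 1 / 2 ^ i"
  have "\<exists>g\<in>grid i. \<bar>c j p p' - g\<bar> \<le> \<delta>" if "j < l" "p \<le> k" "p' \<le> k" for j p p'
    unfolding \<delta>_def using c[OF that] i by (intro grid_approx) simp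
  then obtain g where g: "\<And>j p p'. j < l \<Longrightarrow> p \<le> k \<Longrightarrow> p' \<le> k \<Longrightarrow> g j p p' \<in> grid i \<and> \<bar>c j p p' - g j p p'\<bar> \<le> \<delta>"
    by metis
  define z where "z = (\<lambda>j\<in>{..<l}. \<lambda>p\<in>{..k} \<times> {..k}. g j (fst p) (snd p))"
  have z: "z \<in> net l i" unfolding z_def net_def restrict_PiE_iff using g by auto
  have zg: "\<bar>c j p p' - curry (z j) p p'\<bar> \<le> \<delta>" if "j < l" "p < Suc k" "p' < Suc k" for j p p'
    using g[of j p p'] that by (simp add: z_def)
  define S where "S = L2_span \<mu> ((\<lambda>j. capped (z j)) ` {..<l})"
  have S: "S \<in> net_spaces l i" unfolding S_def net_spaces_def using z by auto
  define t where "t x = (\<Sum>j<l. q j * capped (z j) x)" for x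
  have t: "t \<in> L2_fun \<mu>"
    unfolding t_def[abs_def] by (rule mixture_L2_fun[OF capped_measurable _ q]) (simp add: capped_def)
  then have "t \<in> S" unfolding S_def t_def[abs_def] by (intro sum_mem_L2_span_image) auto
  then have "(L2_setdist \<mu> s S)\<^sup>2 \<le> (L2_dist \<mu> s t)\<^sup>2" by (rule L2_setdist_sq_le)
  also have "\<dots> \<le> 2 * (L2_dist \<mu> s m)\<^sup>2 + 2 * (L2_dist \<mu> m t)\<^sup>2"
    by (intro L2_dist_sq_triangle s m t)
  also have "(L2_dist \<mu> m t)\<^sup>2 \<le> 256 * exp (11 * b) * \<delta>\<^sup>2"
  proof -
    define H where "H x = real (Suc k) * sum_sq (Suc k) (homogenize k \<rho>u x)" for x
    define G where "G x = exp (1 / 8 * (sum_sq k x / \<rho>u\<^sup>2))" for x :: "nat \<Rightarrow> real"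
    have diff: "\<bar>m x - t x\<bar> \<le> exp b * (\<delta> * H x)" for x
    proof -
      have "\<bar>e j x - capped (z j) x\<bar> \<le> exp b * (\<delta> * H x)" if j: "j < l" for j
      proof -
        have "e j x = exp (min b (quad (Suc k) (c j) (homogenize k \<rho>u x)))"
          unfolding e_def using c_le[OF j, of x] by simp
        then have "\<bar>e j x - capped (z j) x\<bar> \<le>
          exp b * \<bar>quad (Suc k) (c j) (homogenize k \<rho>u x) - quad (Suc k) (curry (z j)) (homogenize k \<rho>u x)\<bar>"
          unfolding capped_def using exp_min_Lipschitz by simp
        also have "\<dots> \<le> exp b * (\<delta> * H x)"
          unfolding H_def using zg[OF j] by (intro mult_left_mono quad_diff_le) auto
        finally show ?thesis .
      qed
      then have "(\<Sum>j<l. \<bar>q j * (e j x - capped (z j) x)\<bar>) \<le> (\<Sum>j<l. q j * (exp b * (\<delta> * H x)))"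
        using q by (intro sum_mono) (simp add: abs_mult mult_left_mono)
      also have "\<dots> = exp b * (\<delta> * H x)" using q by (simp add: sum_distrib_right[symmetric])
      finally have le: "(\<Sum>j<l. \<bar>q j * (e j x - capped (z j) x)\<bar>) \<le> exp b * (\<delta> * H x)" .
      have eq: "m x - t x = (\<Sum>j<l. q j * (e j x - capped (z j) x))"
        unfolding m_def t_def by (simp add: sum_subtractf right_diff_distrib)
      show ?thesis unfolding eq by (rule order_trans[OF sum_abs le])
    qed
    have sq: "(m x - t x)\<^sup>2 \<le> 256 * exp (8 * b) * \<delta>\<^sup>2 * G x" for x
    proof -
      have "(m x - t x)\<^sup>2 \<le> (exp b * (\<delta> * H x))\<^sup>2"
        using diff[of x] by (metis abs_ge_zero power2_abs power_mono)
      also have "\<dots> = exp (2 * b) * \<delta>\<^sup>2 * (H x)\<^sup>2" by (simp add: power_mult_distrib exp_double)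
      also have "\<dots> \<le> exp (2 * b) * \<delta>\<^sup>2 * (256 * exp (6 * b) * G x)"
        unfolding H_def G_def by (intro mult_left_mono envelope_sq_le) auto
      also have "\<dots> = 256 * (exp (2 * b) * exp (6 * b)) * \<delta>\<^sup>2 * G x" by simp
      also have "exp (2 * b) * exp (6 * b) = exp (8 * b)" by (simp add: exp_add[symmetric])
      finally show ?thesis .
    qed
    have G_nn: "(\<integral>\<^sup>+x. ennreal (G x) \<partial>\<mu>) = ennreal (sqrt (2 ^ k))"
      unfolding G_def using nn_integral_base_measure_exp[OF \<rho>u, of "1/8" k]
      by (simp add: power_divide real_sqrt_divide)
    have G_meas: "G \<in> borel_measurable \<mu>" unfolding measurable_base G_def[abs_def] by measurable
    have G_int: "integrable \<mu> G"
      using G_nn G_meas by (intro integrableI_nonneg) (auto simp: G_def)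
    have "(LINT x|\<mu>. G x) = sqrt (2 ^ k)"
      using G_nn G_meas by (subst integral_eq_nn_integral) (auto simp: G_def)
    moreover have "(LINT x|\<mu>. (m x - t x)\<^sup>2) \<le> (LINT x|\<mu>. 256 * exp (8 * b) * \<delta>\<^sup>2 * G x)"
      using sq G_int integrable_diff_sq[OF m(1) t] by (intro integral_mono) auto
    ultimately have "(L2_dist \<mu> m t)\<^sup>2 \<le> 256 * exp (8 * b) * \<delta>\<^sup>2 * sqrt (2 ^ k)"
      unfolding L2_dist_sq by simp
    also have "\<dots> \<le> 256 * exp (8 * b) * \<delta>\<^sup>2 * exp (3 * b)"
      by (intro mult_left_mono two_pow_le_exp) auto
    also have "\<dots> = 256 * (exp (8 * b) * exp (3 * b)) * \<delta>\<^sup>2" by simp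
    also have "exp (8 * b) * exp (3 * b) = exp (11 * b)" by (simp add: exp_add[symmetric])
    finally show ?thesis .
  qed
  also have "\<delta>\<^sup>2 = 1 / 4 ^ i" unfolding \<delta>_def
    by (simp add: power_divide power_mult[symmetric] mult.commute[of i]) (simp add: power_mult)
  finally show "\<exists>S\<in>net_spaces l i.
      (L2_setdist \<mu> s S)\<^sup>2 \<le> 2 * (L2_dist \<mu> s (\<lambda>x. \<Sum>j<l. q j * gauss_p k \<rho>u (\<theta> j) x))\<^sup>2
        + 512 * exp (11 * b) / 4 ^ i"
    using S unfolding dist_eq by auto
qed

end

section \<open>Choice of the level and the risk bound\<close>

text \<open>
  A bounded density on a probability space has supremum at least $1$.
\<close>

lemma tau_pos:
  assumes M: "prob_space M" and s: "bounded_density M s" and n: "1 \<le> n"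
  shows "0 < tau n M s"
proof -
  interpret prob_space M by fact
  define E where "E = Linf_norm M s"
  have fin: "E < \<infinity>" and int: "(\<integral>\<^sup>+x. ennreal (s x) \<partial>M) = 1"
    using s by (auto simp: bounded_density_def E_def)
  have le: "AE x in M. ereal \<bar>s x\<bar> \<le> E"
    unfolding E_def Linf_norm_def by (rule esssup_AE)
  have E0: "0 \<le> E"
  proof (rule ccontr)
    assume neg: "\<not> 0 \<le> E"
    from le have "AE x in M. False"
    proof eventually_elim
      fix x assume "ereal \<bar>s x\<bar> \<le> E"
      moreover have "0 \<le> ereal \<bar>s x\<bar>" by simp
      ultimately show False using neg by (meson order_trans)
    qed
    then show False by simp
  qed
  define N where "N = real_of_ereal E"
  have EN: "E = ereal N" "0 \<le> N"
    unfolding N_def using fin E0 by (auto simp: ereal_real real_of_ereal_pos)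
  have "AE x in M. ennreal (s x) \<le> ennreal N"
    using le unfolding EN by eventually_elim (auto intro!: ennreal_leI)
  then have "(\<integral>\<^sup>+x. ennreal (s x) \<partial>M) \<le> (\<integral>\<^sup>+x. ennreal N \<partial>M)" by (rule nn_integral_mono_AE)
  then have "1 \<le> ennreal N" using int by (simp add: emeasure_space_1)
  then have "1 \<le> N" using EN(2) by (metis ennreal_1 ennreal_le_iff)
  then show ?thesis
    unfolding tau_def E_def[symmetric] N_def[symmetric] Let_def using n
    by (intro divide_pos_pos mult_pos_pos) auto
qed

text \<open>
  Since $e^{2L}\tau(1+D)=4le^{2b}$ and $\tau(1+D)\le2lD\tau<2e^b$, one gets $e^b\le e^{2L}$. So $e^{cb}$ is at
  most $e^{2cL}$, and a level proportional to $L$ absorbs it. The number $26$ makes $2^i\ge e^{17(L\vee1)}$,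
  by $\log2\ge2/3$.
\<close>

lemma level_choice:
  fixes b \<tau> l D L Lm :: real
  assumes \<tau>: "0 < \<tau>" and l: "1 \<le> l" and D: "1 \<le> D" and b: "0 \<le> b" and small: "l * D * \<tau> < exp b"
    and L: "L = ln (4 * l * exp (2 * b) * inverse \<tau> / (1 + D)) / 2" and Lm: "Lm = max L 1"
    and i: "i = nat \<lceil>26 * Lm\<rceil>"
  shows "exp (8 * b) \<le> 2 ^ i" "256 * exp (11 * b) / 4 ^ i \<le> l * D * \<tau>" "real i + 1 \<le> 28 * Lm"
proof -
  have Lm1: "1 \<le> Lm" "L \<le> Lm" unfolding Lm by auto
  have e2L: "exp (2 * L) * (\<tau> * (1 + D)) = 4 * l * exp (2 * b)"
  proof -
    have "0 < 4 * l * exp (2 * b) * inverse \<tau> / (1 + D)" using \<tau> l D by simp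
    then have "exp (2 * L) = 4 * l * exp (2 * b) * inverse \<tau> / (1 + D)" unfolding L by simp
    also have "\<dots> = 4 * l * exp (2 * b) / (\<tau> * (1 + D))" by (simp add: divide_inverse)
    finally have eq: "exp (2 * L) = 4 * l * exp (2 * b) / (\<tau> * (1 + D))" .
    have "A / B * B = A" if "B \<noteq> 0" for A B :: real using that by simp
    moreover have "\<tau> * (1 + D) \<noteq> 0" using \<tau> D by simp
    ultimately show ?thesis unfolding eq by blast
  qed
  have "0 \<le> \<lceil>26 * Lm\<rceil>" using Lm1 by simp
  then have ri: "real i = of_int \<lceil>26 * Lm\<rceil>" unfolding i by simp
  have i_ge: "26 * Lm \<le> real i" and i_le: "real i \<le> 26 * Lm + 1"
    unfolding ri by (rule le_of_int_ceiling, rule of_int_ceiling_le_add_one)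
  show "real i + 1 \<le> 28 * Lm" using i_le Lm1 by linarith
  have D2: "\<tau> * (1 + D) \<le> 2 * (l * D * \<tau>)"
  proof -
    have "1 + D \<le> 2 * (1 * D)" using D by simp
    also have "\<dots> \<le> 2 * (l * D)" using l D by (intro mult_left_mono mult_right_mono) auto
    finally have "\<tau> * (1 + D) \<le> \<tau> * (2 * (l * D))" using \<tau> by (intro mult_left_mono) auto
    then show ?thesis by (simp add: mult_ac)
  qed
  have "exp b \<le> exp (2 * L)"
  proof (rule ccontr)
    assume "\<not> exp b \<le> exp (2 * L)"
    then have "4 * l * exp (2 * b) < exp b * (\<tau> * (1 + D))"
      unfolding e2L[symmetric] using \<tau> D by (intro mult_strict_right_mono) auto
    also have "\<dots> \<le> exp b * (2 * exp b)" using D2 small by (intro mult_left_mono) auto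
    also have "\<dots> = 2 * exp (2 * b)" by (simp add: exp_double power2_eq_square)
    finally have "4 * l * exp (2 * b) < 2 * exp (2 * b)" .
    then show False using l by simp
  qed
  then have bL: "b \<le> 2 * Lm" using Lm1 by simp
  have "exp (2 / 3) \<le> (2::real)"
    using ln2_ge_two_thirds by (metis exp_le_cancel_iff exp_ln zero_less_numeral)
  then have "exp (2 / 3) ^ i \<le> (2::real) ^ i" by (rule power_mono) simp
  then have "exp (real i * (2 / 3)) \<le> 2 ^ i" by (simp only: exp_of_nat_mult)
  moreover have "17 * Lm \<le> real i * (2 / 3)" using i_ge Lm1 by simp
  then have "exp (17 * Lm) \<le> exp (real i * (2 / 3))" by simp
  ultimately have two_i: "exp (17 * Lm) \<le> 2 ^ i" by linarith
  have "exp (8 * b) \<le> exp (17 * Lm)" using bL Lm1 by simp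
  with two_i show "exp (8 * b) \<le> 2 ^ i" by linarith
  have "(exp (17 * Lm))\<^sup>2 \<le> (2 ^ i)\<^sup>2" using two_i by (rule power_mono) simp
  moreover have "(2 ^ i)\<^sup>2 = (4 ^ i :: real)"
    unfolding power_mult[symmetric] mult.commute[of i] by (simp add: power_mult)
  moreover have "(exp (17 * Lm))\<^sup>2 = exp (34 * Lm)" by (simp add: exp_double[symmetric])
  ultimately have four_i: "exp (34 * Lm) \<le> 4 ^ i" by simp
  have "2 * (2 * exp (2 * b)) \<le> 4 * l * exp (2 * b)" using l by simp
  also have "\<dots> \<le> exp (2 * Lm) * (2 * (l * D * \<tau>))"
    unfolding e2L[symmetric]
  proof (rule mult_mono)
    show "exp (2 * L) \<le> exp (2 * Lm)" using Lm1 by simp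
  qed (use D2 \<tau> D in simp_all)
  also have "\<dots> = 2 * (exp (2 * Lm) * (l * D * \<tau>))" by simp
  finally have "2 * exp (2 * b) \<le> exp (2 * Lm) * (l * D * \<tau>)"
    by (subst (asm) mult_le_cancel_left_pos) simp
  moreover have "exp (2 * b) \<le> 2 * exp (2 * b)" by simp
  ultimately have low: "exp (2 * b) \<le> exp (2 * Lm) * (l * D * \<tau>)" by (rule order_trans[rotated])
  have "(256::real) \<le> exp 14"
  proof -
    have "(2::real) ^ 14 \<le> exp 1 ^ 14" using exp_ge_add_one_self[of 1] by (intro power_mono) auto
    then show ?thesis by (simp add: exp_of_nat_mult[symmetric])
  qed
  also have "\<dots> \<le> exp (14 * Lm)" using Lm1 by simp
  finally have "256 * exp (11 * b) \<le> exp (14 * Lm) * exp (11 * b)" by (intro mult_right_mono) auto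
  also have "\<dots> = exp (14 * Lm + 9 * b) * exp (2 * b)" by (simp add: exp_add[symmetric])
  also have "\<dots> \<le> exp (32 * Lm) * (exp (2 * Lm) * (l * D * \<tau>))"
    using bL low by (intro mult_mono) auto
  also have "\<dots> = exp (34 * Lm) * (l * D * \<tau>)" by (simp add: exp_add[symmetric] mult.assoc[symmetric])
  also have "\<dots> \<le> 4 ^ i * (l * D * \<tau>)" using four_i l D \<tau> by (intro mult_right_mono) auto
  finally show "256 * exp (11 * b) / 4 ^ i \<le> l * D * \<tau>" by (simp add: field_simps)
qed

context gaussian_setting
begin

text \<open>
  Level $0$ is used when $lD\tau\ge e^b$, the level of \<open>level_choice\<close> otherwise. In both cases the squared
  bias exceeds twice the squared distance to the mixture by at most $2lD\tau$, and the penalty is at most $141\,lD\tau(\mathcal L\vee1)$, where $(k+1)^2\le2D$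
  is used for the number of coefficients.
\<close>

lemma risk_bound:
  fixes \<theta> :: "nat \<Rightarrow> real vec \<times> real mat" and l n :: nat and s :: "(nat \<Rightarrow> real) \<Rightarrow> real"
  defines "D \<equiv> real k * (real k + 1)"
  defines "Lm \<equiv> max (ln (4 * real l * exp (2 * b) * inverse (tau n \<mu> s) / (1 + D)) / 2) 1"
  assumes l: "1 \<le> l" and n: "1 \<le> n" and C0: "0 < C0"
    and risk: "\<And>i S. S \<in> net_spaces l i \<Longrightarrow>
       L2_risk n \<mu> s shat \<le> ennreal C0 * (ennreal ((L2_setdist \<mu> s S)\<^sup>2) +
         ennreal (tau n \<mu> s) * ennreal (real (max (L2_dim \<mu> S) 1) + (real i + 1) +
           2 * (real i + 1) * (real k + 1)\<^sup>2 * real l))"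
    and s: "bounded_density \<mu> s" "s \<in> L2_fun \<mu>"
    and \<theta>: "\<And>j. j < l \<Longrightarrow> \<theta> j \<in> Theta k r \<rho>l \<rho>u"
    and q: "\<And>j. j < l \<Longrightarrow> 0 \<le> q j" "(\<Sum>j<l. q j) = 1"
  shows "L2_risk n \<mu> s shat \<le> ennreal (143 * C0 *
    ((L2_dist \<mu> s (\<lambda>x. \<Sum>j<l. q j * gauss_p k \<rho>u (\<theta> j) x))\<^sup>2 + real l * D * tau n \<mu> s * Lm))"
proof -
  define d where "d = (L2_dist \<mu> s (\<lambda>x. \<Sum>j<l. q j * gauss_p k \<rho>u (\<theta> j) x))\<^sup>2"
  define \<tau> where "\<tau> = tau n \<mu> s"
  define T where "T = real l * D * \<tau>"
  have \<tau>: "0 < \<tau>" unfolding \<tau>_def by (rule tau_pos[OF prob_space_base s(1) n])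
  have k1: "1 \<le> real k" using k by simp
  have l1: "1 \<le> real l" using l by simp
  have kD: "real k + 1 \<le> D" unfolding D_def using k1 mult_right_mono[of 1 "real k" "real k + 1"] by simp
  have D1: "1 \<le> D" using kD k1 by simp
  have Lm1: "1 \<le> Lm" unfolding Lm_def by simp
  have "\<exists>i. \<exists>S\<in>net_spaces l i. (L2_setdist \<mu> s S)\<^sup>2 \<le> 2 * d + 2 * T \<and> real i + 1 \<le> 28 * Lm"
  proof (cases "T < exp b")
    case True
    define i where "i = nat \<lceil>26 * Lm\<rceil>"
    have b0: "0 \<le> b" using b_ge by simp
    have Lm: "Lm = max (ln (4 * real l * exp (2 * b) * inverse \<tau> / (1 + D)) / 2) 1"
      unfolding Lm_def \<tau>_def ..
    note lc = level_choice[OF \<tau> l1 D1 b0 True[unfolded T_def] refl Lm i_def]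
    obtain S where S: "S \<in> net_spaces l i" "(L2_setdist \<mu> s S)\<^sup>2 \<le> 2 * d + 512 * exp (11 * b) / 4 ^ i"
      using mixture_near_net(2)[where \<theta>=\<theta> and q=q and l=l, OF \<theta> q s(2) lc(1)] unfolding d_def by blast
    have "512 * exp (11 * b) / 4 ^ i \<le> 2 * T" using lc(2) unfolding T_def by simp
    then show ?thesis using S lc(3) by (intro exI[of _ i] bexI[of _ S]) auto
  next
    case False
    obtain S where S: "S \<in> net_spaces l 0" using net_nonempty unfolding net_spaces_def by blast
    have "(L2_setdist \<mu> s S)\<^sup>2 \<le> 2 * d + 2 * exp b"
      using mixture_near_net(1)[where \<theta>=\<theta> and q=q and l=l, OF \<theta> q s(2) S] unfolding d_def by blast
    with False S Lm1 show ?thesis by (intro exI[of _ 0] bexI[of _ S]) auto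
  qed
  then obtain i S where S: "S \<in> net_spaces l i" and dist: "(L2_setdist \<mu> s S)\<^sup>2 \<le> 2 * d + 2 * T"
    and i: "real i + 1 \<le> 28 * Lm" by blast
  define B where "B = real (max (L2_dim \<mu> S) 1) + (real i + 1) + 2 * (real i + 1) * (real k + 1)\<^sup>2 * real l"
  have lD: "real l \<le> real l * D" "1 \<le> real l * D"
    using l1 D1 mult_mono[of 1 "real l" 1 D] by (auto simp: mult_le_cancel_left1)
  have Lml: "real l * D \<le> real l * D * Lm" using Lm1 lD(2) by (simp add: mult_le_cancel_left1)
  have B1: "real (max (L2_dim \<mu> S) 1) \<le> real l * D * Lm"
    using net_space_fin_dim(2)[OF S] l lD Lml by (smt (verit) max.bounded_iff of_nat_le_iff)
  have B2: "real i + 1 \<le> 28 * (real l * D * Lm)"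
  proof -
    have "real i + 1 \<le> 28 * Lm * 1" using i by simp
    also have "\<dots> \<le> 28 * Lm * (real l * D)" using lD(2) Lm1 by (intro mult_left_mono) auto
    also have "\<dots> = 28 * (real l * D * Lm)" by simp
    finally show ?thesis .
  qed
  have B3: "2 * (real i + 1) * (real k + 1)\<^sup>2 * real l \<le> 112 * (real l * D * Lm)"
  proof -
    have "(real k + 1) * (real k + 1) \<le> 2 * real k * (real k + 1)"
      using k1 by (intro mult_right_mono) auto
    then have "(real k + 1)\<^sup>2 \<le> 2 * D" unfolding D_def power2_eq_square mult.assoc .
    then have "2 * (real i + 1) * (real k + 1)\<^sup>2 * real l \<le> 2 * (28 * Lm) * (2 * D) * real l"
      using i Lm1 D1 by (intro mult_mono mult_nonneg_nonneg) auto
    then show ?thesis by (simp add: mult_ac)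
  qed
  have B: "B \<le> 141 * (real l * D * Lm)" unfolding B_def using B1 B2 B3 by linarith
  have B0: "0 \<le> B" unfolding B_def by simp
  have d0: "0 \<le> d" unfolding d_def by simp
  have T0: "0 \<le> T" unfolding T_def using \<tau> l1 D1 by simp
  have "L2_risk n \<mu> s shat \<le> ennreal C0 * (ennreal ((L2_setdist \<mu> s S)\<^sup>2) + ennreal \<tau> * ennreal B)"
    using risk[OF S] unfolding \<tau>_def B_def .
  also have "\<dots> = ennreal (C0 * ((L2_setdist \<mu> s S)\<^sup>2 + \<tau> * B))"
    using C0 \<tau> B0 by (simp add: ennreal_mult ennreal_plus)
  also have "\<dots> \<le> ennreal (143 * C0 * (d + T * Lm))"
  proof (rule ennreal_leI)
    have "\<tau> * B \<le> \<tau> * (141 * (real l * D * Lm))" using B \<tau> by (intro mult_left_mono) auto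
    also have "\<dots> = 141 * (T * Lm)" unfolding T_def by (simp add: mult_ac)
    finally have "\<tau> * B \<le> 141 * (T * Lm)" .
    moreover have "T \<le> T * Lm" using Lm1 T0 by (simp add: mult_le_cancel_left1)
    ultimately have "(L2_setdist \<mu> s S)\<^sup>2 + \<tau> * B \<le> 143 * (d + T * Lm)"
      using dist d0 by (simp add: distrib_left)
    then have "C0 * ((L2_setdist \<mu> s S)\<^sup>2 + \<tau> * B) \<le> C0 * (143 * (d + T * Lm))"
      using C0 by (intro mult_left_mono) auto
    then show "C0 * ((L2_setdist \<mu> s S)\<^sup>2 + \<tau> * B) \<le> 143 * C0 * (d + T * Lm)" by (simp add: mult_ac)
  qed
  finally show ?thesis unfolding d_def T_def \<tau>_def .
qed

text \<open>
  Nonemptiness is what makes the infimum over the parametric set meaningful as a real number.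
\<close>

lemma Theta_nonempty: "Theta k r \<rho>l \<rho>u \<noteq> {}"
proof -
  let ?A = "\<rho>l \<cdot>\<^sub>m 1\<^sub>m k :: real mat"
  have A: "?A \<in> carrier_mat k k" by simp
  have mv: "?A *\<^sub>v v = \<rho>l \<cdot>\<^sub>v v" if "v \<in> carrier_vec k" for v
    using smult_mat_mult_vec[OF one_carrier_mat that] that by simp
  have "eigenvalue ?A a \<Longrightarrow> a = \<rho>l" for a
  proof -
    assume "eigenvalue ?A a"
    then obtain v where v: "v \<in> carrier_vec k" "v \<noteq> 0\<^sub>v k" "?A *\<^sub>v v = a \<cdot>\<^sub>v v"
      unfolding eigenvalue_def eigenvector_def by auto
    then have eq: "\<rho>l \<cdot>\<^sub>v v = a \<cdot>\<^sub>v v" using mv by simp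
    obtain i where i: "i < k" "vec_index v i \<noteq> 0"
      using v by (metis carrier_vecD eq_vecI index_zero_vec)
    have "\<rho>l * vec_index v i = a * vec_index v i"
      using arg_cong[OF eq, of "\<lambda>w. vec_index w i"] v i by simp
    then show "a = \<rho>l" using i by simp
  qed
  moreover have "0 < scalar_prod v (?A *\<^sub>v v)" if "v \<in> carrier_vec k" "v \<noteq> 0\<^sub>v k" for v
    using that \<rho>l scalar_prod_self_eq_0[of v k] scalar_prod_self_nonneg[of v] by (simp add: mv)
  moreover have "transpose_mat ?A = ?A" by (rule eq_matI) auto
  moreover have "sqrt (scalar_prod (0\<^sub>v k) (0\<^sub>v k)) \<le> r" using r by (simp add: scalar_prod_def)
  moreover have "\<rho>l \<in> {\<rho>l..\<rho>u}" using \<rho>lu by simp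
  ultimately have "(0\<^sub>v k, ?A) \<in> Theta k r \<rho>l \<rho>u"
    unfolding Theta_def sym_pos_def_def mem_Collect_eq prod.case
    using A by (metis zero_carrier_vec)
  then show ?thesis by blast
qed

text \<open>
  The factor $e^b$ in $g$ cancels the normalization $e^{-b/2}$ of $u$.
\<close>

lemma mixing_forms_T_set_eq:
  assumes u: "u \<in> {..<l} \<rightarrow>\<^sub>E T_set k r \<rho>l \<rho>u b" and g: "g \<in> mixing_forms l b"
  shows "\<exists>\<theta> q. (\<forall>j<l. \<theta> j \<in> Theta k r \<rho>l \<rho>u) \<and> (\<forall>j<l. 0 \<le> q j) \<and> (\<Sum>j<l. q j) = 1 \<and>
    (\<forall>x. g (\<lambda>j. u j x) = (\<Sum>j<l. q j * gauss_p k \<rho>u (\<theta> j) x))"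
proof -
  have "\<forall>j\<in>{..<l}. \<exists>\<theta>. \<theta> \<in> Theta k r \<rho>l \<rho>u \<and> u j = (\<lambda>x. exp (- b / 2) * sqrt (gauss_p k \<rho>u \<theta> x))"
  proof
    fix j assume "j \<in> {..<l}"
    then have "u j \<in> T_set k r \<rho>l \<rho>u b" using u by (rule PiE_mem[rotated])
    then show "\<exists>\<theta>. \<theta> \<in> Theta k r \<rho>l \<rho>u \<and> u j = (\<lambda>x. exp (- b / 2) * sqrt (gauss_p k \<rho>u \<theta> x))"
      unfolding T_set_def image_def by blast
  qed
  then obtain \<theta> where "\<forall>j\<in>{..<l}. \<theta> j \<in> Theta k r \<rho>l \<rho>u \<and>
      u j = (\<lambda>x. exp (- b / 2) * sqrt (gauss_p k \<rho>u (\<theta> j) x))"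
    by (rule bchoice[THEN exE])
  then have \<theta>: "\<And>j. j < l \<Longrightarrow> \<theta> j \<in> Theta k r \<rho>l \<rho>u"
    and u_eq: "\<And>j. j < l \<Longrightarrow> u j = (\<lambda>x. exp (- b / 2) * sqrt (gauss_p k \<rho>u (\<theta> j) x))" by auto
  obtain q where g_eq: "g = (\<lambda>y. \<Sum>j<l. exp b * q j * (y j)\<^sup>2)"
    and q: "\<forall>j<l. q j \<in> {0..1}" "(\<Sum>j<l. q j) = 1"
    using g unfolding mixing_forms_def by blast
  have "g (\<lambda>j. u j x) = (\<Sum>j<l. q j * gauss_p k \<rho>u (\<theta> j) x)" for x
    unfolding g_eq
  proof (intro sum.cong refl)
    fix j assume "j \<in> {..<l}"
    then have "u j x = exp (- b / 2) * sqrt (gauss_p k \<rho>u (\<theta> j) x)" using u_eq by simp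
    moreover have "0 \<le> gauss_p k \<rho>u (\<theta> j) x" unfolding gauss_p_def by (simp add: split_def)
    moreover have "exp b * (exp (- b / 2))\<^sup>2 = 1" by (simp add: exp_double[symmetric] exp_add[symmetric])
    ultimately show "exp b * q j * (u j x)\<^sup>2 = q j * gauss_p k \<rho>u (\<theta> j) x"
      by (simp add: power_mult_distrib mult_ac)
  qed
  then show ?thesis using \<theta> q by (intro exI[of _ \<theta>] exI[of _ q]) auto
qed

end

theorem corollary4:
  assumes model_selection_theorem:
    "\<exists>C0>0. \<forall>(k::nat) (n::nat) (\<rho>::real). 1 \<le> k \<and> 1 \<le> n \<and> 0 < \<rho> \<longrightarrow>
       model_selection C0 n (base_measure k \<rho>)"
  shows
    "\<exists>C::real. C > 0 \<and> (\<forall>(k::nat) (l::nat) (n::nat) (r::real) (\<rho>l::real) (\<rho>u::real).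
       1 \<le> k \<and> 1 \<le> l \<and> 1 \<le> n \<and> 0 < r \<and> 0 < \<rho>l \<and> \<rho>l < \<rho>u \<longrightarrow>
       (let \<mu> = base_measure k \<rho>u;
            M = sqrt (real k) * \<rho>u + r;
            b = r\<^sup>2 / (2 * \<rho>u\<^sup>2) + real k * ln (sqrt 2 * \<rho>u / \<rho>l);
            R = sqrt (real k / 2) * exp (- b / 2) / \<rho>l;
            L = (\<lambda>t::real. ln (4 * real l * exp (2 * b) * inverse t / (1 + real k * (real k + 1))) / 2)
        in \<exists>shat. estimator n \<mu> shat \<and>
             (\<forall>s. bounded_density \<mu> s \<and> s \<in> L2_fun \<mu> \<longrightarrow>
                ennreal C * L2_risk n \<mu> s shat \<le>
                ennreal
                  ((INF (u, g) \<in> ({..<l} \<rightarrow>\<^sub>E T_set k r \<rho>l \<rho>u b) \<times> mixing_forms l b.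
                      (L2_dist \<mu> s (\<lambda>x. g (\<lambda>j. u j x)))\<^sup>2) +
                   real l * real k * (real k + 1) * tau n \<mu> s *
                     (ln (1 + 2 * M * R) + max (L (tau n \<mu> s)) 1)))))"
proof -
  obtain C0 where C0: "0 < C0"
    and ms: "\<And>k n \<rho>. 1 \<le> k \<Longrightarrow> 1 \<le> n \<Longrightarrow> 0 < \<rho> \<Longrightarrow> model_selection C0 n (base_measure k \<rho>)"
    using model_selection_theorem by blast
  \<comment> \<open>\<open>143\<close> is the constant of \<open>risk_bound\<close>: \<open>2\<close> from the bias and \<open>141\<close> from the penalty\<close>
  define C where "C = 1 / (143 * C0)"
  have C: "0 < C" unfolding C_def using C0 by simp
  show ?thesis
  proof (intro exI[of _ C] conjI allI impI C)
    fix k l n :: nat and r \<rho>l \<rho>u :: real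
    assume H: "1 \<le> k \<and> 1 \<le> l \<and> 1 \<le> n \<and> 0 < r \<and> 0 < \<rho>l \<and> \<rho>l < \<rho>u"
    define b where "b = r\<^sup>2 / (2 * \<rho>u\<^sup>2) + real k * ln (sqrt 2 * \<rho>u / \<rho>l)"
    define \<mu> where "\<mu> = base_measure k \<rho>u"
    define lnMR where "lnMR = ln (1 + 2 * (sqrt (real k) * \<rho>u + r) * (sqrt (real k / 2) * exp (- b / 2) / \<rho>l))"
    define L where "L t = ln (4 * real l * exp (2 * b) * inverse t / (1 + real k * (real k + 1))) / 2" for t :: real
    interpret gaussian_setting k r \<rho>l \<rho>u b
      using H b_def by unfold_locales auto
    have lnMR: "0 \<le> lnMR"
      unfolding lnMR_def using H by (intro ln_ge_zero) (simp add: \<rho>u less_imp_le)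
    obtain shat where shat: "estimator n \<mu> shat"
      and risk: "\<And>s i S. bounded_density \<mu> s \<Longrightarrow> S \<in> net_spaces l i \<Longrightarrow>
       L2_risk n \<mu> s shat \<le> ennreal C0 * (ennreal ((L2_setdist \<mu> s S)\<^sup>2) +
         ennreal (tau n \<mu> s) * ennreal (real (max (L2_dim \<mu> S) 1) + (real i + 1) +
           2 * (real i + 1) * (real k + 1)\<^sup>2 * real l))"
      unfolding \<mu>_def
    proof (rule model_selection_over_finite_families[where F="net_spaces l" and ?C0.0=C0 and n=n and M="base_measure k \<rho>u"
          and w="\<lambda>i. 2 * (real i + 1) * (real k + 1)\<^sup>2 * real l"])
      show "model_selection C0 n (base_measure k \<rho>u)" using H \<rho>u by (intro ms) auto
      show "finite (net_spaces l i)" "net_spaces l i \<noteq> {}" for i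
        unfolding net_spaces_def using finite_net net_nonempty by auto
    qed (use net_space_fin_dim(1) card_net_spaces_le in auto)
    have bound: "ennreal C * L2_risk n \<mu> s shat \<le>
        ennreal ((INF (u, g) \<in> ({..<l} \<rightarrow>\<^sub>E T_set k r \<rho>l \<rho>u b) \<times> mixing_forms l b.
                      (L2_dist \<mu> s (\<lambda>x. g (\<lambda>j. u j x)))\<^sup>2) +
                   real l * real k * (real k + 1) * tau n \<mu> s * (lnMR + max (L (tau n \<mu> s)) 1))"
      if s: "bounded_density \<mu> s" "s \<in> L2_fun \<mu>" for s
    proof -
      define X where "X = ({..<l} \<rightarrow>\<^sub>E T_set k r \<rho>l \<rho>u b) \<times> mixing_forms l b"
      define P where "P = real l * real k * (real k + 1) * tau n \<mu> s * (lnMR + max (L (tau n \<mu> s)) 1)"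
      have \<tau>: "0 < tau n \<mu> s"
        unfolding \<mu>_def using H s \<mu>_def by (intro tau_pos prob_space_base) auto
      have le: "L2_risk n \<mu> s shat \<le> ennreal (143 * C0 * ((L2_dist \<mu> s (\<lambda>x. g (\<lambda>j. u j x)))\<^sup>2 + P))"
        if ug: "(u, g) \<in> X" for u g
      proof -
        have u: "u \<in> {..<l} \<rightarrow>\<^sub>E T_set k r \<rho>l \<rho>u b" and g: "g \<in> mixing_forms l b"
          using ug unfolding X_def by auto
        obtain \<theta> q where \<theta>q: "\<And>j. j < l \<Longrightarrow> \<theta> j \<in> Theta k r \<rho>l \<rho>u"
          "\<And>j. j < l \<Longrightarrow> 0 \<le> q j" "(\<Sum>j<l. q j) = 1"
          and eq: "\<And>x. g (\<lambda>j. u j x) = (\<Sum>j<l. q j * gauss_p k \<rho>u (\<theta> j) x)"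
          using mixing_forms_T_set_eq[OF u g] by blast
        have "L2_risk n \<mu> s shat \<le> ennreal (143 * C0 * ((L2_dist \<mu> s (\<lambda>x. g (\<lambda>j. u j x)))\<^sup>2 +
            real l * (real k * (real k + 1)) * tau n \<mu> s * max (L (tau n \<mu> s)) 1))"
          unfolding eq L_def using H C0 s \<theta>q risk[OF s(1)] unfolding \<mu>_def
          by (intro risk_bound) auto
        also have "\<dots> \<le> ennreal (143 * C0 * ((L2_dist \<mu> s (\<lambda>x. g (\<lambda>j. u j x)))\<^sup>2 + P))"
        proof (intro ennreal_leI mult_left_mono add_left_mono)
          show "real l * (real k * (real k + 1)) * tau n \<mu> s * max (L (tau n \<mu> s)) 1 \<le> P"
            unfolding P_def mult.assoc[symmetric] using lnMR \<tau> by (intro mult_left_mono) auto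
        qed (use C0 in auto)
        finally show ?thesis .
      qed
      have "T_set k r \<rho>l \<rho>u b \<noteq> {}" unfolding T_set_def using Theta_nonempty by simp
      then have "({..<l} \<rightarrow>\<^sub>E T_set k r \<rho>l \<rho>u b) \<noteq> {}" by (simp add: PiE_eq_empty_iff)
      moreover have "mixing_forms l b \<noteq> {}"
      proof -
        have "(\<Sum>j<l. if j = 0 then 1 else (0::real)) = 1" using H by simp
        then have "(\<lambda>y. \<Sum>j<l. exp b * (if j = 0 then 1 else 0) * (y j)\<^sup>2) \<in> mixing_forms l b"
          unfolding mixing_forms_def by (intro CollectI exI[of _ "\<lambda>j. if j = 0 then 1 else 0"]) auto
        then show ?thesis by blast
      qed
      ultimately have X: "X \<noteq> {}" unfolding X_def by auto
      then obtain u0 g0 where "(u0, g0) \<in> X" by auto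
      from le[OF this] have fin: "L2_risk n \<mu> s shat < \<infinity>" by (rule order_le_less_trans) simp
      define \<rho> where "\<rho> = enn2real (L2_risk n \<mu> s shat)"
      have \<rho>: "L2_risk n \<mu> s shat = ennreal \<rho>" "0 \<le> \<rho>" unfolding \<rho>_def using fin by auto
      \<comment> \<open>the bound holds for each \<open>u\<close> and \<open>g\<close>, so it passes to the infimum after subtracting the penalty\<close>
      have "C * \<rho> - P \<le> (case z of (u, g) \<Rightarrow> (L2_dist \<mu> s (\<lambda>x. g (\<lambda>j. u j x)))\<^sup>2)" if "z \<in> X" for z
      proof -
        obtain u g where z: "z = (u, g)" by (cases z)
        have P0: "0 \<le> P" unfolding P_def using lnMR \<tau> by simp
        have "\<rho> \<le> 143 * C0 * ((L2_dist \<mu> s (\<lambda>x. g (\<lambda>j. u j x)))\<^sup>2 + P)"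
          using le[of u g] that P0 C0 unfolding z \<rho> by (subst (asm) ennreal_le_iff) auto
        then have "C * \<rho> \<le> (L2_dist \<mu> s (\<lambda>x. g (\<lambda>j. u j x)))\<^sup>2 + P"
          unfolding C_def using C0 by (simp add: field_simps)
        then show ?thesis unfolding z by simp
      qed
      then have "C * \<rho> - P \<le> (INF (u, g) \<in> X. (L2_dist \<mu> s (\<lambda>x. g (\<lambda>j. u j x)))\<^sup>2)"
        using X by (intro cINF_greatest) auto
      then have "C * \<rho> \<le> (INF (u, g) \<in> X. (L2_dist \<mu> s (\<lambda>x. g (\<lambda>j. u j x)))\<^sup>2) + P" by simp
      moreover have "ennreal C * L2_risk n \<mu> s shat = ennreal (C * \<rho>)"
        unfolding \<rho>(1) using C \<rho>(2) by (simp add: ennreal_mult)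
      ultimately show ?thesis
        unfolding X_def[symmetric] P_def[symmetric] by (simp add: ennreal_leI)
    qed
    show "let \<mu> = base_measure k \<rho>u;
            M = sqrt (real k) * \<rho>u + r;
            b = r\<^sup>2 / (2 * \<rho>u\<^sup>2) + real k * ln (sqrt 2 * \<rho>u / \<rho>l);
            R = sqrt (real k / 2) * exp (- b / 2) / \<rho>l;
            L = (\<lambda>t::real. ln (4 * real l * exp (2 * b) * inverse t / (1 + real k * (real k + 1))) / 2)
        in \<exists>shat. estimator n \<mu> shat \<and>
             (\<forall>s. bounded_density \<mu> s \<and> s \<in> L2_fun \<mu> \<longrightarrow>
                ennreal C * L2_risk n \<mu> s shat \<le>
                ennreal
                  ((INF (u, g) \<in> ({..<l} \<rightarrow>\<^sub>E T_set k r \<rho>l \<rho>u b) \<times> mixing_forms l b.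
                      (L2_dist \<mu> s (\<lambda>x. g (\<lambda>j. u j x)))\<^sup>2) +
                   real l * real k * (real k + 1) * tau n \<mu> s *
                     (ln (1 + 2 * M * R) + max (L (tau n \<mu> s)) 1)))"
      unfolding Let_def b_def[symmetric] \<mu>_def[symmetric] lnMR_def[symmetric] L_def[symmetric]
      using shat bound by blast
  qed
qed

end
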